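(* Consider the online contextual decision-making problem and the online algorithm described in the context, in the soft constraints case (the algorithm runs for all $T$ rounds without terminating upon constraint violation, and $0\in\mathcal{V}$ is not required). Let $r_{\mathrm{avg}} := \frac1T\sum_{t=1}^T r_t^Tw_t$ and $v_{\mathrm{avg}} := \frac1T\sum_{t=1}^T V_t^Tw_t$. Suppose the following hold. (1) There exist constants $\kappa_{\mathrm{risk}}, \alpha > 0$ such that for every integer $n > 0$, with $(x_i,\mu_i)_{i=1}^n$ i.i.d. from $\mathbb{P}$ and, for each $\omega \in \Lambda \times \Theta$, $\hat g^n = \hat g^n_\omega \in \arg\min_{g \in \mathcal{H}} \sum_{i=1}^n \ell(g(x_i), \mu_i; \omega)$, $$\mathbb{E}\Big[\sup_{\omega \in \Lambda \times \Theta} \{R_{\mathrm{SPO}}(\hat g^n; \omega) - R_{\mathrm{SPO}}(g^*; \omega)\}\Big] \le \kappa_{\mathrm{risk}} \cdot n^{-\alpha}.$$ (2) There exists a constant $D_v \ge 1$ such that for any $w \in \mathcal{S}$, $\|V^T w\| \le D_v$ with probability $1$. Let $\kappa_{\mathrm{MD}} := D_v \cdot (\zeta \sqrt{D_\Theta} + \sqrt{D_\Lambda})$. (3) There exists a constant $\zeta_{\mathrm{OPT}}$ such that $\mathrm{OPT}^\epsilon \le \mathrm{OPT} + \zeta_{\mathrm{OPT}}\cdot\epsilon$ for all $\epsilon>0$, where $\mathrm{OPT}^\epsilon := \sup_\pi\{\mathrm{rew}(\pi)+u(\mathrm{con}(\pi))\}$ over policies $\pi$ with $d_{\mathcal{V}}(\mathrm{con}(\pi))\le\epsilon$.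 Then the algorithm satisfies $$\mathrm{OPT} - \mathbb{E}[r_{\mathrm{avg}} + u(v_{\mathrm{avg}})] \le \kappa_{\mathrm{MD}}\cdot\mathcal{O}(T^{-1/2}) + \kappa_{\mathrm{risk}}\cdot\mathcal{O}(T^{-\alpha}).$$ If additionally $\zeta \ge 2\Big(\zeta_{\mathrm{OPT}} + \frac{\sqrt{D_\Lambda}}{\sqrt{D_\Theta}} + \frac{\kappa_{\mathrm{risk}}}{D_v\sqrt{D_\Theta}}\Big)$, then $$\mathbb{E}[d_{\mathcal{V}}(v_{\mathrm{avg}})] \le D_v\sqrt{D_\Theta}\cdot\mathcal{O}(T^{-1/2}) + \mathcal{O}(T^{-\alpha}).$$ Here the notation $\mathcal{O}$ omits only absolute constants.
   Context: Problem. $\mathcal{S} \subseteq \mathbb{R}^d$ is convex and compact; $\mathcal{V} \subseteq \mathbb{R}^m$ is closed and convex; $u : \mathbb{R}^m \to \mathbb{R}$ is concave and $L$-Lipschitz with respect to a given norm $\|\cdot\|$ on $\mathbb{R}^m$ (dual norm $\|\cdot\|_*$), with $u(0)=0$. There are $T$ rounds. Tuples $(x_t, r_t, V_t)$, $t=1,\dots,T$, with context $x_t \in \mathcal{X} \subseteq \mathbb{R}^p$, reward $r_t \in \mathbb{R}^d$ and consumption matrix $V_t \in \mathbb{R}^{d\times m}$, are i.i.d. from an unknown distribution $\mathbb{P}$ (such that the expectations below exist). In round $t$, $x_t$ is observed, a decision $w_t \in \mathcal{S}$ is made, and then $r_t, V_t$ are revealed; the consumption is $v_t := V_t^T w_t$.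 Benchmark. For a policy $\pi : \mathcal{X} \to \mathcal{S}$, $\mathrm{rew}(\pi) := \mathbb{E}[r^T\pi(x)]$, $\mathrm{con}(\pi) := \mathbb{E}[V^T\pi(x)]$ with $(x,r,V)\sim\mathbb{P}$, and $\mathrm{OPT} := \sup_\pi\{\mathrm{rew}(\pi) + u(\mathrm{con}(\pi))\}$ over policies with $\mathrm{con}(\pi) \in \mathcal{V}$. Dual quantities. $d_{\mathcal{V}}(v) := \inf_{\tilde v \in \mathcal{V}}\|\tilde v - v\|$. $f^*(y) := \sup_x\{y^Tx - f(x)\}$ is the Fenchel conjugate. $\Lambda$ and $\Theta$ are the domains of $(-u)^*$ and $d_{\mathcal{V}}^*$. Write $\mu = (r,V)$, $\omega = (\lambda,\theta) \in \Lambda\times\Theta$; $\zeta > 0$ is a fixed budget penalty parameter. Losses. The oracle $w^*$ satisfies $w^*(\mu;\omega) \in \arg\max_{w \in \mathcal{S}} (r - V\lambda - \zeta V\theta)^Tw$. For a prediction $\hat\mu = (\hat r,\hat V)$, $\ell_{\mathrm{SPO}}(\hat\mu,\mu;\omega) := (r - V\lambda - \zeta V\theta)^T(w^*(\mu;\omega) - w^*(\hat\mu;\omega))$. Given a surrogate loss $\ell:\mathbb{R}^d\times\mathbb{R}^d\to\mathbb{R}$, $\ell(\hat\mu,\mu;\omega) := \ell(\hat r - \hat V\lambda - \zeta\hat V\theta,\; r - V\lambda - \zeta V\theta)$. $R_{\mathrm{SPO}}(g;\omega) := \mathbb{E}_{(x,\mu)\sim\mathbb{P}}[\ell_{\mathrm{SPO}}(g(x),\mu;\omega)]$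 and $g^*(x) := \mathbb{E}[\mu\mid x]$. $\mathcal{H}$ is a hypothesis class of functions $g:\mathbb{R}^p\to\mathbb{R}^d\times\mathbb{R}^{d\times m}$. Mirror descent. $\xi_t(\lambda) := -v_t^T\lambda + (-u)^*(\lambda)$ on $\Lambda$, $\phi_t(\theta) := -v_t^T\theta + d_{\mathcal{V}}^*(\theta)$ on $\Theta$; $\nabla$ denotes any subgradient. $h_\Lambda, h_\Theta$ are differentiable and $1$-strongly convex with respect to $\|\cdot\|_*$ on $\Lambda,\Theta$, with Bregman distances $B_h(a,b) := h(a)-h(b)-\nabla h(b)^T(a-b)$. $D_\Lambda,D_\Theta>0$ are upper bounds for $B_{h_\Lambda}$ on $\Lambda\times\Lambda$ and $B_{h_\Theta}$ on $\Theta\times\Theta$; $G_\Lambda,G_\Theta>0$ are upper bounds with $\|\nabla\xi_t(\lambda_t)\|\le G_\Lambda$, $\|\nabla\phi_t(\theta_t)\|\le G_\Theta$ for all $t=1,\dots,T$. Step sizes: $\eta_\lambda = \sqrt{D_\Lambda}/(G_\Lambda\sqrt T)$, $\eta_\theta = \sqrt{D_\Theta}/(G_\Theta\sqrt T)$. Algorithm. Initialize dual variables $\lambda_1\in\Lambda$, $\theta_1\in\Theta$ and a prediction model $g_1$. For $t=1,\dots,T$: observe $x_t$; set $(\hat r_t,\hat V_t) = g_t(x_t)$; play $w_t = w^*((\hat r_t,\hat V_t);(\lambda_t,\theta_t))$, i.e. a maximizer of $(\hat r_t - \hat V_t\lambda_t - \zeta\hat V_t\theta_t)^Tw$ over $\mathcal{S}$;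 observe $r_t,V_t$; set $\lambda_{t+1} = \arg\min_{\lambda\in\Lambda}\{\eta_\lambda\nabla\xi_t(\lambda_t)^T\lambda + B_{h_\Lambda}(\lambda,\lambda_t)\}$, $\theta_{t+1} = \arg\min_{\theta\in\Theta}\{\eta_\theta\nabla\phi_t(\theta_t)^T\theta + B_{h_\Theta}(\theta,\theta_t)\}$, and $g_{t+1}\in\arg\min_{g\in\mathcal{H}}\sum_{s=1}^t\ell(g(x_s),\mu_s;\omega_{t+1})$ with $\omega_{t+1}=(\lambda_{t+1},\theta_{t+1})$.
   Formalization: O(.) is read as: for all large T, factor 10. As printed the bounds fail; the T^{-1/2} terms carry an extra factor max(1, G_Λ/D_v, G_Θ/D_v), and the T^{-α} term of the distance bound an extra factor D_v√D_Θ. *)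

theory Defs
  imports "HOL-Probability.Probability"
begin

section \<open>Convex analysis with respect to an arbitrary norm\<close>

definition is_norm :: "('a::real_vector \<Rightarrow> real) \<Rightarrow> bool" where
  "is_norm N \<longleftrightarrow> (\<forall>x. N x = 0 \<longleftrightarrow> x = 0) \<and> (\<forall>c x. N (c *\<^sub>R x) = \<bar>c\<bar> * N x)
     \<and> (\<forall>x y. N (x + y) \<le> N x + N y)"

definition dual_norm :: "('a::real_inner \<Rightarrow> real) \<Rightarrow> 'a \<Rightarrow> real" where
  "dual_norm N y = (SUP x\<in>{x. N x \<le> 1}. y \<bullet> x)"

definition dist_to :: "('a::real_vector \<Rightarrow> real) \<Rightarrow> 'a set \<Rightarrow> 'a \<Rightarrow> real" where
  "dist_to N A v = (INF a\<in>A. N (a - v))"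

definition fenchel_conj :: "('a::real_inner \<Rightarrow> real) \<Rightarrow> 'a \<Rightarrow> ereal" where
  "fenchel_conj f y = (SUP x. ereal (y \<bullet> x - f x))"

definition conj_domain :: "('a::real_inner \<Rightarrow> real) \<Rightarrow> 'a set" where
  "conj_domain f = {y. fenchel_conj f y < \<infinity>}"

definition is_subgradient :: "('a::real_inner \<Rightarrow> ereal) \<Rightarrow> 'a \<Rightarrow> 'a \<Rightarrow> bool" where
  "is_subgradient F x p \<longleftrightarrow> \<bar>F x\<bar> \<noteq> \<infinity> \<and> (\<forall>y. F x + ereal (p \<bullet> (y - x)) \<le> F y)"

definition strongly_convex1_on ::
    "'a set \<Rightarrow> ('a::real_vector \<Rightarrow> real) \<Rightarrow> ('a \<Rightarrow> real) \<Rightarrow> bool" where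
  "strongly_convex1_on A N h \<longleftrightarrow> (\<forall>x\<in>A. \<forall>y\<in>A. \<forall>s\<in>{0..1}.
     h (s *\<^sub>R x + (1 - s) *\<^sub>R y) \<le> s * h x + (1 - s) * h y - s * (1 - s) / 2 * (N (x - y))\<^sup>2)"

definition is_gradient_on :: "'a set \<Rightarrow> ('a::real_inner \<Rightarrow> real) \<Rightarrow> ('a \<Rightarrow> 'a) \<Rightarrow> bool" where
  "is_gradient_on A h gh \<longleftrightarrow> (\<forall>b\<in>A. (h has_derivative (\<lambda>v. gh b \<bullet> v)) (at b within A))"

definition bregman :: "('a::real_inner \<Rightarrow> real) \<Rightarrow> ('a \<Rightarrow> 'a) \<Rightarrow> 'a \<Rightarrow> 'a \<Rightarrow> real" where
  "bregman h gh a b = h a - h b - gh b \<bullet> (a - b)"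


section \<open>Observations, policies and the benchmark\<close>

text \<open>
  An outcome \<open>\<mu> = (r, V)\<close> consists of a reward vector in \<open>\<real>\<^sup>d\<close> and a \<open>d \<times> m\<close> consumption matrix;
  an observation is \<open>(x, \<mu>)\<close> with a context \<open>x\<close> in \<open>\<real>\<^sup>p\<close>.
\<close>

type_synonym ('d, 'm) outcome = "(real ^ 'd) \<times> (real ^ 'm ^ 'd)"
type_synonym ('p, 'd, 'm) obs = "(real ^ 'p) \<times> ('d, 'm) outcome"

abbreviation context_space :: "(real ^ 'p::finite) set \<Rightarrow> (real ^ 'p) measure" where
  "context_space X \<equiv> restrict_space borel X"

text \<open>
  The law of \<open>n\<close> i.i.d. observations, indexed by \<open>1, \<dots>, n\<close>.
\<close>

abbreviation iid :: "('p::finite, 'd::finite, 'm::finite) obs measure \<Rightarrow> nat \<Rightarrow> (nat \<Rightarrow> ('p, 'd, 'm) obs) measure" where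
  "iid P n \<equiv> PiM {1..n} (\<lambda>_. P)"

definition policies :: "(real ^ 'p::finite) set \<Rightarrow> (real ^ 'd::finite) set \<Rightarrow> (real ^ 'p \<Rightarrow> real ^ 'd) set" where
  "policies X S = {\<pi> \<in> borel_measurable (context_space X). \<forall>x\<in>X. \<pi> x \<in> S}"

definition rew :: "('p::finite, 'd::finite, 'm::finite) obs measure \<Rightarrow> (real ^ 'p \<Rightarrow> real ^ 'd) \<Rightarrow> real" where
  "rew P \<pi> = (\<integral>(x, r, V). r \<bullet> \<pi> x \<partial>P)"

definition con :: "('p::finite, 'd::finite, 'm::finite) obs measure \<Rightarrow> (real ^ 'p \<Rightarrow> real ^ 'd) \<Rightarrow> real ^ 'm" where
  "con P \<pi> = (\<integral>(x, r, V). transpose V *v \<pi> x \<partial>P)"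

text \<open>
  The suprema are extended reals, so that they are \<open>-\<infinity>\<close> if no policy is feasible.
\<close>

definition OPT :: "('p::finite, 'd::finite, 'm::finite) obs measure \<Rightarrow> (real ^ 'p) set \<Rightarrow> (real ^ 'd) set \<Rightarrow>
    (real ^ 'm) set \<Rightarrow> (real ^ 'm \<Rightarrow> real) \<Rightarrow> ereal" where
  "OPT P X S \<V> u = (SUP \<pi>\<in>{\<pi> \<in> policies X S. con P \<pi> \<in> \<V>}. ereal (rew P \<pi> + u (con P \<pi>)))"

definition OPT_relaxed :: "('p::finite, 'd::finite, 'm::finite) obs measure \<Rightarrow> (real ^ 'p) set \<Rightarrow> (real ^ 'd) set \<Rightarrow>
    (real ^ 'm) set \<Rightarrow> (real ^ 'm \<Rightarrow> real) \<Rightarrow> (real ^ 'm \<Rightarrow> real) \<Rightarrow> real \<Rightarrow> ereal" where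
  "OPT_relaxed P X S \<V> u N \<epsilon> =
     (SUP \<pi>\<in>{\<pi> \<in> policies X S. dist_to N \<V> (con P \<pi>) \<le> \<epsilon>}. ereal (rew P \<pi> + u (con P \<pi>)))"


section \<open>Losses and prediction models\<close>

text \<open>
  Dual variables are pairs \<open>\<omega> = (\<lambda>, \<theta>)\<close>; the coefficient vector is \<open>r - V \<lambda> - \<zeta> V \<theta>\<close>.
\<close>

definition coeff_vec :: "real \<Rightarrow> ('d::finite, 'm::finite) outcome \<Rightarrow> (real ^ 'm) \<times> (real ^ 'm) \<Rightarrow> real ^ 'd" where
  "coeff_vec \<zeta> \<mu> \<omega> = fst \<mu> - snd \<mu> *v fst \<omega> - \<zeta> *\<^sub>R (snd \<mu> *v snd \<omega>)"

definition spo_loss :: "(('d::finite, 'm::finite) outcome \<Rightarrow> (real ^ 'm) \<times> (real ^ 'm) \<Rightarrow> real ^ 'd) \<Rightarrow> real \<Rightarrow>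
    ('d, 'm) outcome \<Rightarrow> ('d, 'm) outcome \<Rightarrow> (real ^ 'm) \<times> (real ^ 'm) \<Rightarrow> real" where
  "spo_loss wstar \<zeta> \<mu>' \<mu> \<omega> = coeff_vec \<zeta> \<mu> \<omega> \<bullet> (wstar \<mu> \<omega> - wstar \<mu>' \<omega>)"

definition surrogate_loss :: "(real ^ 'd::finite \<Rightarrow> real ^ 'd \<Rightarrow> real) \<Rightarrow> real \<Rightarrow>
    ('d, 'm::finite) outcome \<Rightarrow> ('d, 'm) outcome \<Rightarrow> (real ^ 'm) \<times> (real ^ 'm) \<Rightarrow> real" where
  "surrogate_loss l \<zeta> \<mu>' \<mu> \<omega> = l (coeff_vec \<zeta> \<mu>' \<omega>) (coeff_vec \<zeta> \<mu> \<omega>)"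

definition spo_risk :: "('p::finite, 'd::finite, 'm::finite) obs measure \<Rightarrow>
    (('d, 'm) outcome \<Rightarrow> (real ^ 'm) \<times> (real ^ 'm) \<Rightarrow> real ^ 'd) \<Rightarrow> real \<Rightarrow>
    (real ^ 'p \<Rightarrow> ('d, 'm) outcome) \<Rightarrow> (real ^ 'm) \<times> (real ^ 'm) \<Rightarrow> real" where
  "spo_risk P wstar \<zeta> g \<omega> = (\<integral>(x, \<mu>). spo_loss wstar \<zeta> (g x) \<mu> \<omega> \<partial>P)"

text \<open>
  \<open>g x = E[\<mu> | x]\<close>, componentwise, because the library's conditional expectation is real-valued.
\<close>

definition is_cond_mean :: "(real ^ 'p::finite) set \<Rightarrow> ('p, 'd::finite, 'm::finite) obs measure \<Rightarrow>
    (real ^ 'p \<Rightarrow> ('d, 'm) outcome) \<Rightarrow> bool" where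
  "is_cond_mean X P g \<longleftrightarrow> g \<in> borel_measurable (context_space X) \<and>
     (let F = vimage_algebra (space P) fst (context_space X) in
        (\<forall>i. AE z in P. fst (g (fst z)) $ i = real_cond_exp P F (\<lambda>(x, r, V). r $ i) z) \<and>
        (\<forall>i j. AE z in P. snd (g (fst z)) $ i $ j = real_cond_exp P F (\<lambda>(x, r, V). V $ i $ j) z))"

definition empirical_loss :: "(real ^ 'd::finite \<Rightarrow> real ^ 'd \<Rightarrow> real) \<Rightarrow> real \<Rightarrow> nat \<Rightarrow>
    (nat \<Rightarrow> ('p::finite, 'd, 'm::finite) obs) \<Rightarrow> (real ^ 'm) \<times> (real ^ 'm) \<Rightarrow>
    (real ^ 'p \<Rightarrow> ('d, 'm) outcome) \<Rightarrow> real" where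
  "empirical_loss l \<zeta> n z \<omega> g = (\<Sum>i=1..n. surrogate_loss l \<zeta> (g (fst (z i))) (snd (z i)) \<omega>)"


section \<open>Runs of the algorithm\<close>

text \<open>
  All quantities produced by the algorithm are functions of the data sequence \<open>z\<close>.
  A process value is known after \<open>n\<close> rounds if it is a measurable function of the first \<open>n\<close>
  observations.
\<close>

definition known_after :: "('p::finite, 'd::finite, 'm::finite) obs measure \<Rightarrow> nat \<Rightarrow>
    ((nat \<Rightarrow> ('p, 'd, 'm) obs) \<Rightarrow> real ^ 'm) \<Rightarrow> bool" where
  "known_after P n f \<longleftrightarrow> f \<in> borel_measurable (iid P n) \<and> (\<forall>z. f z = f (restrict z {1..n}))"

text \<open>
  \<open>mirror_descent A f h gh \<eta> T v y p\<close>: over the rounds \<open>1, \<dots>, T\<close>, the iterates \<open>y\<close> follow mirror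
  descent on \<open>A\<close> with step size \<open>\<eta>\<close> for the losses \<open>y \<mapsto> - v t \<bullet> y + f\<^sup>* y\<close>, where
  \<open>p t\<close> is the subgradient used in round \<open>t\<close>.
\<close>

definition mirror_descent :: "'a set \<Rightarrow> ('a::real_inner \<Rightarrow> real) \<Rightarrow> ('a \<Rightarrow> real) \<Rightarrow> ('a \<Rightarrow> 'a) \<Rightarrow>
    real \<Rightarrow> nat \<Rightarrow> (nat \<Rightarrow> 'a) \<Rightarrow> (nat \<Rightarrow> 'a) \<Rightarrow> (nat \<Rightarrow> 'a) \<Rightarrow> bool" where
  "mirror_descent A f h gh \<eta> T v y p \<longleftrightarrow> (\<forall>t\<in>{1..T}.
     is_subgradient (\<lambda>a. ereal (- (v t \<bullet> a)) + fenchel_conj f a) (y t) (p t) \<and>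
     is_arg_min (\<lambda>a. \<eta> * (p t \<bullet> a) + bregman h gh a (y t)) (\<lambda>a. a \<in> A) (y (Suc t)))"

definition consumption :: "(nat \<Rightarrow> ('p::finite, 'd::finite, 'm::finite) obs) \<Rightarrow> (nat \<Rightarrow> real ^ 'd) \<Rightarrow> nat \<Rightarrow> real ^ 'm" where
  "consumption z w t = transpose (snd (snd (z t))) *v w t"

definition avg_reward :: "nat \<Rightarrow> (nat \<Rightarrow> ('p::finite, 'd::finite, 'm::finite) obs) \<Rightarrow> (nat \<Rightarrow> real ^ 'd) \<Rightarrow> real" where
  "avg_reward T z w = (1 / real T) * (\<Sum>t=1..T. fst (snd (z t)) \<bullet> w t)"

definition avg_consumption :: "nat \<Rightarrow> (nat \<Rightarrow> ('p::finite, 'd::finite, 'm::finite) obs) \<Rightarrow> (nat \<Rightarrow> real ^ 'd) \<Rightarrow> real ^ 'm" where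
  "avg_consumption T z w = (1 / real T) *\<^sub>R (\<Sum>t=1..T. consumption z w t)"

end

(*
  In round t, condition on the past, which fixes the prediction model and the dual variables.
  Up to the excess SPO risk, the decision is as good for the Lagrangian reward
  r - V (lambda + zeta theta) as the decision based on the conditional mean, hence at least as good
  as any feasible policy. Summing over t, the dual variables leave as error terms the regrets of the
  two mirror descents, because the best fixed dual variables in hindsight turn the dual losses into
  u (v_avg) and - d (v_avg) by Fenchel duality. This yields
    OPT <= E [r_avg + u (v_avg)] - zeta E [d (v_avg)] + error,
  and with it the first bound. Conversely, averaging the decisions over the rounds and the past
  gives a policy whose expected consumption has distance at most E [d (v_avg)] from the constraint
  set, so that E [r_avg + u (v_avg)] <= OPT + zeta_OPT E [d (v_avg)]; the second bound follows
  because zeta exceeds zeta_OPT.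
*)

theory Submission
  imports Defs
begin

section \<open>Norms and conjugates\<close>

text \<open>Model and dual pair of round t are functions of the first t - 1 observations, so each
  round is an integral over the product of \<open>P\<close> with the law of the past. The pair
  depends on the same sample as the model, which is why the risk hypothesis has its supremum over
  pairs inside the expectation. Two leftovers stand in the way of absolute constants for every T:
  the arbitrary model \<open>g1\<close> contributes a fixed excess in round 1, and the mean of n
  powr -\<alpha> is a multiple of T powr -\<alpha> only for \<alpha> < 1, with a factor that blows
  up near 1. The former, and for \<alpha> > 1/2 also the latter, is of smaller order than T powr
  (-1/2); for large T it is charged to the mirror descent term, hence the \<open>eventually\<close>.
  The share charged is proportional to \<zeta>, because the second bound divides the error by
  \<zeta> - \<open>\<zeta>_OPT\<close>, which the penalty condition keeps above \<zeta> / 2 plus the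
  two ratios it contains.\<close>

lemma is_normD:
  assumes "is_norm N"
  shows "N x = 0 \<longleftrightarrow> x = 0" "N (c *\<^sub>R x) = \<bar>c\<bar> * N x" "N (x + y) \<le> N x + N y"
    "N 0 = 0" "N (- x) = N x" "N x \<ge> 0" "N (x - y) = N (y - x)"
proof -
  show *: "N x = 0 \<longleftrightarrow> x = 0" "N (c *\<^sub>R x) = \<bar>c\<bar> * N x" "N (x + y) \<le> N x + N y" for x y c
    using assms by (auto simp: is_norm_def)
  show 0: "N 0 = 0" by (simp add: *)
  show m: "N (- x) = N x" for x using *(2)[of "-1" x] by simp
  show "N x \<ge> 0" using *(3)[of x "- x"] 0 m[of x] by simp
  show "N (x - y) = N (y - x)" using m[of "x - y"] by simp
qed

lemma norm_le_euclidean: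
  fixes N :: "'a::euclidean_space \<Rightarrow> real"
  assumes "is_norm N"
  obtains C where "C > 0" "\<And>x. N x \<le> C * norm x"
proof
  note n = is_normD[OF assms]
  have sum_le: "N (\<Sum>i\<in>A. f i) \<le> (\<Sum>i\<in>A. N (f i))" if "finite A" for A and f :: "'a \<Rightarrow> 'a"
    using that by (induction A) (auto simp: n(4) intro: order_trans[OF n(3)])
  show "(\<Sum>b\<in>Basis. N b) + 1 > 0"
    by (simp add: add_nonneg_pos sum_nonneg n(6))
  show "N x \<le> ((\<Sum>b\<in>Basis. N b) + 1) * norm x" for x
  proof -
    have "N x = N (\<Sum>b\<in>Basis. (x \<bullet> b) *\<^sub>R b)" by (simp add: euclidean_representation)
    also have "\<dots> \<le> (\<Sum>b\<in>Basis. \<bar>x \<bullet> b\<bar> * N b)"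
      using sum_le[OF finite_Basis, of "\<lambda>b. (x \<bullet> b) *\<^sub>R b"] by (simp add: n(2))
    also have "\<dots> \<le> (\<Sum>b\<in>Basis. norm x * N b)"
      by (intro sum_mono mult_right_mono n(6)) (auto simp: Basis_le_norm)
    also have "\<dots> \<le> ((\<Sum>b\<in>Basis. N b) + 1) * norm x"
      by (subst sum_distrib_left[symmetric]) (simp add: algebra_simps)
    finally show ?thesis .
  qed
qed

lemma lipschitz_continuous_on:
  fixes f :: "'a::euclidean_space \<Rightarrow> real"
  assumes "is_norm N" and f: "\<And>a b. \<bar>f a - f b\<bar> \<le> L * N (a - b)"
  shows "continuous_on UNIV f"
proof -
  obtain C where C: "C > 0" "\<And>x. N x \<le> C * norm x" using norm_le_euclidean[OF assms(1)] by blast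
  have "\<bar>f a - f b\<bar> \<le> (\<bar>L\<bar> * C) * dist a b" for a b
  proof -
    have "L * N (a - b) \<le> \<bar>L\<bar> * (C * norm (a - b))"
      by (intro mult_mono) (auto simp: C is_normD[OF assms(1)])
    then show ?thesis using f[of a b] by (simp add: dist_norm)
  qed
  then have "(\<bar>L\<bar> * C)-lipschitz_on UNIV f"
    using C by (auto simp: lipschitz_on_def dist_real_def)
  then show ?thesis by (rule lipschitz_on_continuous_on)
qed

text \<open>Compactness: \<open>N\<close> is continuous and positive on the Euclidean unit sphere,
  hence at least its positive minimum there, and homogeneity extends the bound. The estimate makes
  the supremum in \<open>dual_norm\<close> finite.\<close>

lemma euclidean_le_norm:
  fixes N :: "'a::euclidean_space \<Rightarrow> real"
  assumes "is_norm N"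
  obtains C where "C > 0" "\<And>x. norm x \<le> C * N x"
proof -
  note n = is_normD[OF assms]
  have "\<bar>N a - N b\<bar> \<le> 1 * N (a - b)" for a b
    using n(3)[of "a - b" b] n(3)[of "b - a" a] n(7)[of a b] by auto
  then have cont: "continuous_on UNIV N" by (rule lipschitz_continuous_on[OF assms])
  obtain e :: 'a where e: "norm e = 1" using vector_choose_size[of 1] by auto
  have "\<exists>x\<in>sphere 0 1. \<forall>y\<in>sphere 0 1. N x \<le> N y"
    by (rule continuous_attains_inf) (use e in \<open>auto intro: continuous_on_subset[OF cont]\<close>)
  then obtain x0 where x0: "norm x0 = 1" "\<And>y. norm y = 1 \<Longrightarrow> N x0 \<le> N y" by auto
  have pos: "N x0 > 0" using n(1)[of x0] n(6)[of x0] x0(1) by (metis less_eq_real_def norm_zero zero_neq_one)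
  show ?thesis
  proof
    show "1 / N x0 > 0" using pos by simp
    show "norm x \<le> 1 / N x0 * N x" for x
    proof (cases "x = 0")
      case False
      have "N x0 \<le> N ((1 / norm x) *\<^sub>R x)" using False by (intro x0) simp
      also have "\<dots> = N x / norm x" by (simp add: n(2))
      finally show ?thesis using pos False by (simp add: field_simps)
    qed (simp add: n)
  qed
qed

text \<open>The real supremum in \<open>dual_norm\<close> bounds its members only if they are
  bounded above, which the comparison with the Euclidean norm provides; scaling \<open>x\<close> to
  \<open>N\<close>-length 1 does the rest.\<close>

lemma inner_le_dual_norm:
  fixes N :: "'a::euclidean_space \<Rightarrow> real"
  assumes "is_norm N"
  shows "y \<bullet> x \<le> dual_norm N y * N x"
proof (cases "x = 0")
  case False
  note n = is_normD[OF assms]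
  obtain C where C: "C > 0" "\<And>x. norm x \<le> C * N x" using euclidean_le_norm[OF assms] by blast
  have "bdd_above ((\<lambda>x. y \<bullet> x) ` {x. N x \<le> 1})"
  proof (rule bdd_aboveI2)
    fix x assume "x \<in> {x. N x \<le> 1}"
    then have "norm x \<le> C" using C(1) C(2)[of x] mult_left_mono[of "N x" 1 C] by (simp; linarith)
    then show "y \<bullet> x \<le> norm y * C"
      using norm_cauchy_schwarz[of y x] mult_left_mono[of "norm x" C "norm y"] by simp
  qed
  moreover have pos: "N x > 0" using n(1)[of x] n(6)[of x] False by simp
  ultimately have "y \<bullet> ((1 / N x) *\<^sub>R x) \<le> dual_norm N y"
    unfolding dual_norm_def by (intro cSUP_upper) (simp add: n(2))
  with pos show ?thesis by (simp add: field_simps)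
qed (simp add: is_normD[OF assms])

text \<open>The point lying \<open>e\<close> below the graph is strictly separated from the closed
  epigraph. The slack forces the vertical component \<open>s\<close> of the normal to be positive,
  so the hyperplane is the graph of an affine minorant; at a point of the graph itself a vertical
  hyperplane would have to be excluded.\<close>

lemma approx_subgradient:
  fixes f :: "'a::euclidean_space \<Rightarrow> real"
  assumes "convex_on UNIV f" "continuous_on UNIV f" "e > 0"
  obtains p where "\<And>y. f v + p \<bullet> (y - v) - e \<le> f y"
proof -
  have "closed {z. f (fst z) \<le> snd z}"
    by (intro closed_Collect_le continuous_intros continuous_on_compose2[OF assms(2)]) auto
  then have cl: "closed (epigraph UNIV f)" by (simp add: epigraph_def)
  have "(v, f v - e) \<notin> epigraph UNIV f" using \<open>e > 0\<close> by (simp add: epigraph_def)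
  from separating_hyperplane_closed_point[OF convex_epigraphI[OF assms(1)] cl this]
  obtain a b where ab: "a \<bullet> (v, f v - e) < b" "\<And>z. z \<in> epigraph UNIV f \<Longrightarrow> b < a \<bullet> z" by blast
  obtain q s where a: "a = (q, s)" by force
  have *: "q \<bullet> v + s * (f v - e) < q \<bullet> y + s * f y" for y
    using ab(1) ab(2)[of "(y, f y)"] by (simp add: a epigraph_def)
  have s: "s > 0" using *[of v] \<open>e > 0\<close> by (simp add: algebra_simps zero_less_mult_iff)
  show ?thesis
  proof
    fix y
    have "s * (f v - e) - q \<bullet> (y - v) < s * f y" using *[of y] by (simp add: algebra_simps)
    then have "f v - e - (q \<bullet> (y - v)) / s < f y" using s by (simp add: field_simps)
    then show "f v + (- (1 / s) *\<^sub>R q) \<bullet> (y - v) - e \<le> f y" by (simp add: field_simps)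
  qed
qed

section \<open>Conjugates of real-valued functions and their domains\<close>

lemma fenchel_conj_real:
  assumes "y \<in> conj_domain f"
  obtains c where "fenchel_conj f y = ereal c" "\<forall>x. y \<bullet> x - f x \<le> c"
    "\<forall>b. (\<forall>x. y \<bullet> x - f x \<le> b) \<longrightarrow> c \<le> b"
proof -
  have "fenchel_conj f y < \<infinity>" using assms by (simp add: conj_domain_def)
  moreover have ge: "ereal (y \<bullet> x - f x) \<le> fenchel_conj f y" for x
    unfolding fenchel_conj_def by (rule SUP_upper) simp
  ultimately obtain c where c: "fenchel_conj f y = ereal c"
    using ge[of 0] by (cases "fenchel_conj f y") auto
  show ?thesis
  proof
    show "fenchel_conj f y = ereal c" by fact
    show "\<forall>x. y \<bullet> x - f x \<le> c" using ge c by simp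
    show "\<forall>b. (\<forall>x. y \<bullet> x - f x \<le> b) \<longrightarrow> c \<le> b"
    proof (intro allI impI)
      fix b assume b: "\<forall>x. y \<bullet> x - f x \<le> b"
      have "fenchel_conj f y \<le> ereal b" unfolding fenchel_conj_def by (rule SUP_least) (simp add: b)
      then show "c \<le> b" by (simp add: c)
    qed
  qed
qed

lemma conj_domainI:
  assumes "\<And>x. y \<bullet> x - f x \<le> b"
  shows "y \<in> conj_domain f"
proof -
  have "fenchel_conj f y \<le> ereal b" unfolding fenchel_conj_def by (rule SUP_least) (simp add: assms)
  then show ?thesis by (auto simp: conj_domain_def)
qed

lemma convex_conj_domain: "convex (conj_domain f)"
proof (rule convexI)
  fix x y :: 'a and s t :: real
  assume xy: "x \<in> conj_domain f" "y \<in> conj_domain f" and st: "0 \<le> s" "0 \<le> t" "s + t = 1"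
  obtain a where a: "\<forall>z. x \<bullet> z - f z \<le> a" using xy(1) by (rule fenchel_conj_real)
  obtain b where b: "\<forall>z. y \<bullet> z - f z \<le> b" using xy(2) by (rule fenchel_conj_real)
  show "s *\<^sub>R x + t *\<^sub>R y \<in> conj_domain f"
  proof (rule conj_domainI)
    fix z
    have "(s *\<^sub>R x + t *\<^sub>R y) \<bullet> z - (s + t) * f z = s * (x \<bullet> z - f z) + t * (y \<bullet> z - f z)"
      by (simp add: algebra_simps)
    also have "\<dots> \<le> s * a + t * b" by (intro add_mono mult_left_mono a[rule_format] b[rule_format] st)
    finally show "(s *\<^sub>R x + t *\<^sub>R y) \<bullet> z - f z \<le> s * a + t * b" using st by simp
  qed
qed

text \<open>The conjugate is tested along the ray through \<open>y\<close> itself: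
  \<open>y \<bullet> (k *\<^sub>R y) - f (k *\<^sub>R y)\<close> grows at least like
  \<open>k * (y \<bullet> y - L * N y)\<close>, so this factor cannot be positive. The resulting
  bound on the dual variables is what makes the integrands of the rounds integrable.\<close>

lemma conj_domain_bounded:
  fixes N :: "'a::euclidean_space \<Rightarrow> real"
  assumes "is_norm N" and f: "\<And>a b. \<bar>f a - f b\<bar> \<le> L * N (a - b)"
  obtains B where "B > 0" "\<And>y. y \<in> conj_domain f \<Longrightarrow> norm y \<le> B"
proof -
  obtain C where C: "C > 0" "\<And>x. N x \<le> C * norm x" using norm_le_euclidean[OF assms(1)] by blast
  note n = is_normD[OF assms(1)]
  show ?thesis
  proof
    show "\<bar>L\<bar> * C + 1 > 0" using C by (simp add: add_nonneg_pos)
    fix y assume "y \<in> conj_domain f"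
    then obtain c where c: "\<forall>x. y \<bullet> x - f x \<le> c" by (rule fenchel_conj_real)
    have "(y \<bullet> y - L * N y) * k \<le> c + f 0" if "k > 0" for k :: real
      using c[rule_format, of "k *\<^sub>R y"] f[of "k *\<^sub>R y" 0] that by (simp add: n algebra_simps)
    then have le: "y \<bullet> y - L * N y \<le> 0"
    proof -
      have False if "y \<bullet> y - L * N y > 0" (is "?d > 0")
      proof -
        have "?d * ((\<bar>c + f 0\<bar> + 1) / ?d) \<le> c + f 0"
          by (rule \<open>\<And>k. k > 0 \<Longrightarrow> _\<close>) (use that in \<open>auto intro!: divide_pos_pos\<close>)
        then show False using that by simp
      qed
      then show ?thesis by fastforce
    qed
    have "L * N y \<le> \<bar>L\<bar> * (C * norm y)" by (intro mult_mono) (auto simp: C n)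
    with le have "norm y * norm y \<le> (\<bar>L\<bar> * C) * norm y" by (simp add: power2_norm_eq_inner[symmetric] power2_eq_square)
    then have "norm y \<le> \<bar>L\<bar> * C" using C(1) by (cases "norm y = 0") (auto simp: mult_le_cancel_right)
    then show "norm y \<le> \<bar>L\<bar> * C + 1" by simp
  qed
qed

section \<open>The distance to a set in an arbitrary norm\<close>

lemma dist_to_le: "is_norm N \<Longrightarrow> a \<in> A \<Longrightarrow> dist_to N A v \<le> N (a - v)"
  unfolding dist_to_def by (rule cINF_lower) (auto intro!: bdd_belowI2[where m=0] is_normD(6)[where N=N])

lemma dist_to_nonneg: "is_norm N \<Longrightarrow> A \<noteq> {} \<Longrightarrow> dist_to N A v \<ge> 0"
  unfolding dist_to_def by (rule cINF_greatest) (auto intro: is_normD(6)[where N=N])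

lemma dist_to_approx:
  assumes "is_norm N" "A \<noteq> {}" "e > 0"
  obtains a where "a \<in> A" "N (a - v) < dist_to N A v + e"
proof -
  have "(INF a\<in>A. N (a - v)) < dist_to N A v + e" using assms by (simp add: dist_to_def)
  moreover have "bdd_below ((\<lambda>a. N (a - v)) ` A)"
    by (auto intro!: bdd_belowI2[where m=0] is_normD(6)[where N=N] assms)
  ultimately have "\<exists>a\<in>A. N (a - v) < dist_to N A v + e"
    by (subst (asm) cINF_less_iff) (use assms in auto)
  then show ?thesis using that by blast
qed

lemma dist_to_eq_0: "is_norm N \<Longrightarrow> v \<in> A \<Longrightarrow> dist_to N A v = 0"
  using dist_to_le[of N v A v] dist_to_nonneg[of N A v] is_normD(4)[of N] by fastforce

text \<open>The factor 1 keeps the shape \<open>L * N (a - b)\<close> of the Lipschitz hypothesis on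
  \<open>u\<close>, so that the same lemmas serve both functions.\<close>

lemma dist_to_lipschitz:
  assumes "is_norm N" "A \<noteq> {}"
  shows "\<bar>dist_to N A v - dist_to N A w\<bar> \<le> 1 * N (v - w)"
proof -
  note n = is_normD[OF assms(1)]
  have *: "dist_to N A v \<le> dist_to N A w + N (v - w)" for v w
  proof (rule field_le_epsilon)
    fix e :: real assume "e > 0"
    then obtain a where a: "a \<in> A" "N (a - w) < dist_to N A w + e"
      using dist_to_approx assms by blast
    have "N (a - v) \<le> N (a - w) + N (w - v)" using n(3)[of "a - w" "w - v"] by simp
    then show "dist_to N A v \<le> dist_to N A w + N (v - w) + e"
      using a dist_to_le[OF assms(1) a(1), of v] n(7)[of v w] by simp
  qed
  show ?thesis using *[of v w] *[of w v] n(7)[of v w] by simp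
qed

lemma dist_to_convex:
  assumes "is_norm N" "A \<noteq> {}" "convex A"
  shows "convex_on UNIV (dist_to N A)"
proof (rule convex_onI)
  note n = is_normD[OF assms(1)]
  fix t :: real and x y assume t: "0 < t" "t < 1"
  show "dist_to N A ((1 - t) *\<^sub>R x + t *\<^sub>R y) \<le> (1 - t) * dist_to N A x + t * dist_to N A y"
  proof (rule field_le_epsilon)
    fix e :: real assume e: "e > 0"
    obtain a where a: "a \<in> A" "N (a - x) < dist_to N A x + e" using dist_to_approx assms e by blast
    obtain b where b: "b \<in> A" "N (b - y) < dist_to N A y + e" using dist_to_approx assms e by blast
    have "(1 - t) *\<^sub>R a + t *\<^sub>R b \<in> A" using assms(3) a(1) b(1) t by (auto simp: convex_alt)
    then have "dist_to N A ((1 - t) *\<^sub>R x + t *\<^sub>R y)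
        \<le> N (((1 - t) *\<^sub>R a + t *\<^sub>R b) - ((1 - t) *\<^sub>R x + t *\<^sub>R y))" by (rule dist_to_le[OF assms(1)])
    also have "\<dots> = N ((1 - t) *\<^sub>R (a - x) + t *\<^sub>R (b - y))" by (simp add: algebra_simps)
    also have "\<dots> \<le> (1 - t) * N (a - x) + t * N (b - y)"
      using n(3)[of "(1 - t) *\<^sub>R (a - x)" "t *\<^sub>R (b - y)"] t by (simp add: n(2))
    also have "\<dots> \<le> (1 - t) * (dist_to N A x + e) + t * (dist_to N A y + e)"
      using a b t by (intro add_mono mult_left_mono) auto
    finally show "dist_to N A ((1 - t) *\<^sub>R x + t *\<^sub>R y)
        \<le> (1 - t) * dist_to N A x + t * dist_to N A y + e" by (simp add: algebra_simps)
  qed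
qed simp

section \<open>Mirror descent\<close>

text \<open>The gradient is only given within \<open>A\<close>, which may have empty interior;
  derivatives are therefore one-sided and taken along segments inside \<open>A\<close>.\<close>

lemma gradient_along_segment:
  fixes h :: "'a::real_inner \<Rightarrow> real"
  assumes "convex A" "is_gradient_on A h gh" "b \<in> A" "a \<in> A"
  shows "((\<lambda>s. (h (b + s *\<^sub>R (a - b)) - h b) / s) \<longlongrightarrow> gh b \<bullet> (a - b)) (at 0 within {0..1})"
    "s \<in> {0..1} \<Longrightarrow> b + s *\<^sub>R (a - b) \<in> A"
proof -
  let ?f = "\<lambda>s::real. b + s *\<^sub>R (a - b)"
  show inA: "?f s \<in> A" if "s \<in> {0..1}" for s
    using convexD_alt[OF assms(1,3,4), of s] that by (simp add: algebra_simps)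
  have hd: "(h has_derivative (\<lambda>v. gh b \<bullet> v)) (at b within A)"
    using assms(2,3) by (auto simp: is_gradient_on_def)
  have "(h has_derivative (\<lambda>v. gh b \<bullet> v)) (at (?f 0) within ?f ` {0..1})"
    by (rule has_derivative_subset[where s = A]) (use hd inA in auto)
  then have "((\<lambda>s. h (?f s)) has_derivative (\<lambda>s. gh b \<bullet> (s *\<^sub>R (a - b)))) (at 0 within {0..1})"
    by (rule has_derivative_in_compose[rotated]) (auto intro!: derivative_eq_intros)
  moreover have "(\<lambda>s. gh b \<bullet> (s *\<^sub>R (a - b))) = (*) (gh b \<bullet> (a - b))" by (auto simp: mult.commute)
  ultimately have "((\<lambda>s. h (?f s)) has_real_derivative gh b \<bullet> (a - b)) (at 0 within {0..1})"
    unfolding has_field_derivative_def by metis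
  then show "((\<lambda>s. (h (?f s) - h b) / s) \<longlongrightarrow> gh b \<bullet> (a - b)) (at 0 within {0..1})"
    by (simp add: has_field_derivative_iff)
qed

lemma at_0_within_unit_neq_bot: "at 0 within {0..1::real} \<noteq> bot"
  by (simp add: at_within_Icc_at_right)

text \<open>At a minimizer the difference quotients of the objective towards any \<open>a\<close> in
  \<open>A\<close> are nonnegative, and so is their limit.\<close>

lemma gradient_optimality:
  fixes h :: "'a::real_inner \<Rightarrow> real"
  assumes "convex A" "is_gradient_on A h gh" "b \<in> A" "a \<in> A"
    and min: "\<And>c. c \<in> A \<Longrightarrow> p \<bullet> b + h b \<le> p \<bullet> c + h c"
  shows "(p + gh b) \<bullet> (a - b) \<ge> 0"
proof -
  let ?f = "\<lambda>s::real. b + s *\<^sub>R (a - b)"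
  note seg = gradient_along_segment[OF assms(1-4)]
  have lim: "((\<lambda>s. p \<bullet> (a - b) + (h (?f s) - h b) / s) \<longlongrightarrow> p \<bullet> (a - b) + gh b \<bullet> (a - b)) (at 0 within {0..1})"
    by (intro tendsto_intros seg)
  have "p \<bullet> (a - b) + (h (?f s) - h b) / s \<ge> 0" if "s \<in> {0..1}" "s \<noteq> 0" for s
  proof -
    have "0 \<le> s * (p \<bullet> (a - b)) + (h (?f s) - h b)"
      using min[OF seg(2)[OF that(1)]] by (simp add: algebra_simps)
    then show ?thesis using that by (simp add: field_simps)
  qed
  then have "\<forall>\<^sub>F s in at 0 within {0..1::real}. p \<bullet> (a - b) + (h (?f s) - h b) / s \<ge> 0"
    unfolding eventually_at_filter by (intro always_eventually allI impI)
  from tendsto_lowerbound[OF lim this at_0_within_unit_neq_bot] show ?thesis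
    by (simp add: inner_add_left)
qed

text \<open>Strong convexity on the segment from \<open>b\<close> to \<open>a\<close>, divided by
  \<open>s\<close>, bounds the difference quotient of \<open>h\<close>; letting \<open>s\<close>
  tend to 0 turns the quotient into the gradient term.\<close>

lemma bregman_lower:
  fixes h :: "'a::real_inner \<Rightarrow> real"
  assumes "convex A" "is_gradient_on A h gh" "strongly_convex1_on A M h" "a \<in> A" "b \<in> A"
  shows "bregman h gh a b \<ge> 1 / 2 * (M (a - b))\<^sup>2"
proof -
  let ?f = "\<lambda>s::real. b + s *\<^sub>R (a - b)"
  note lim = gradient_along_segment(1)[OF assms(1,2,5,4)]
  have lim2: "((\<lambda>s. h a - h b - (1 - s) / 2 * (M (a - b))\<^sup>2) \<longlongrightarrow> h a - h b - (1 - 0) / 2 * (M (a - b))\<^sup>2)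
      (at 0 within {0..1})"
    by (intro tendsto_intros) auto
  have "(h (?f s) - h b) / s \<le> h a - h b - (1 - s) / 2 * (M (a - b))\<^sup>2" if "s \<in> {0..1}" "s \<noteq> 0" for s
  proof -
    have "h (s *\<^sub>R a + (1 - s) *\<^sub>R b) \<le> s * h a + (1 - s) * h b - s * (1 - s) / 2 * (M (a - b))\<^sup>2"
      using assms(3,4,5) that unfolding strongly_convex1_on_def by blast
    moreover have "s *\<^sub>R a + (1 - s) *\<^sub>R b = ?f s" by (simp add: algebra_simps)
    ultimately have "h (?f s) - h b \<le> s * (h a - h b - (1 - s) / 2 * (M (a - b))\<^sup>2)"
      by (simp add: algebra_simps)
    then show ?thesis using that by (simp add: field_simps)
  qed
  then have "\<forall>\<^sub>F s in at 0 within {0..1::real}. (h (?f s) - h b) / s \<le> h a - h b - (1 - s) / 2 * (M (a - b))\<^sup>2"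
    unfolding eventually_at_filter by (intro always_eventually allI impI)
  from tendsto_le[OF at_0_within_unit_neq_bot lim2 lim this] show ?thesis by (simp add: bregman_def)
qed

text \<open>Three-point argument: written with Bregman distances, the optimality condition at
  \<open>y'\<close> leaves \<open>bregman h gh y' y\<close> with a negative sign. By strong
  convexity this absorbs the quadratic part of the cost of moving from \<open>y\<close> to
  \<open>y'\<close>.\<close>

lemma mirror_descent_step:
  fixes h :: "'a::euclidean_space \<Rightarrow> real"
  assumes N: "is_norm N" and A: "convex A" "is_gradient_on A h gh" "strongly_convex1_on A (dual_norm N) h"
    and y: "y \<in> A" "a \<in> A" and \<eta>: "\<eta> > 0" and p: "N p \<le> G"
    and min: "is_arg_min (\<lambda>a. \<eta> * (p \<bullet> a) + bregman h gh a y) (\<lambda>a. a \<in> A) y'"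
  shows "\<eta> * (p \<bullet> (y - a)) \<le> bregman h gh a y - bregman h gh a y' + \<eta>\<^sup>2 * G\<^sup>2 / 2"
proof -
  have y': "y' \<in> A" using min by (simp add: is_arg_min_def)
  \<comment> \<open>Up to a constant the objective is \<open>h\<close> plus the linear function with
    coefficient \<open>\<eta> *\<^sub>R p - gh y\<close>.\<close>
  have "(\<eta> *\<^sub>R p - gh y) \<bullet> y' + h y' \<le> (\<eta> *\<^sub>R p - gh y) \<bullet> c + h c" if "c \<in> A" for c
    using min that by (force simp: is_arg_min_def bregman_def algebra_simps not_less)
  from gradient_optimality[OF A(1,2) y' y(2) this]
  have opt: "(\<eta> *\<^sub>R p - gh y + gh y') \<bullet> (a - y') \<ge> 0" .
  have low: "bregman h gh y' y \<ge> 1 / 2 * (dual_norm N (y' - y))\<^sup>2"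
    by (rule bregman_lower[OF A(1,2,3) y' y(1)])
  let ?d = "dual_norm N (y' - y)"
  have "\<eta> * (p \<bullet> (y - y')) = \<eta> * ((y' - y) \<bullet> (- p))" by (simp add: inner_commute algebra_simps)
  also have "\<dots> \<le> \<eta> * (?d * N (- p))"
    by (intro mult_left_mono inner_le_dual_norm N) (use \<eta> in auto)
  \<comment> \<open>Young's inequality for the product of the movement \<open>?d\<close> and
    \<open>\<eta> * N p\<close>.\<close>
  also have "\<dots> \<le> 1 / 2 * ?d\<^sup>2 + \<eta>\<^sup>2 * (N p)\<^sup>2 / 2"
    using sum_squares_bound[of ?d "\<eta> * N p"] by (simp add: is_normD[OF N] power_mult_distrib algebra_simps)
  also have "\<dots> \<le> 1 / 2 * ?d\<^sup>2 + \<eta>\<^sup>2 * G\<^sup>2 / 2"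
    using p is_normD(6)[OF N, of p] by (simp add: mult_left_mono power_mono)
  finally have 1: "\<eta> * (p \<bullet> (y - y')) \<le> 1 / 2 * ?d\<^sup>2 + \<eta>\<^sup>2 * G\<^sup>2 / 2" .
  show ?thesis using opt low 1 by (simp add: bregman_def algebra_simps inner_commute)
qed

text \<open>The range reaches \<open>Suc T\<close> because the telescoping sum in the regret bound
  ends at the iterate after the last round.\<close>

lemma mirror_descent_in:
  assumes md: "mirror_descent A f h gh \<eta> T v y p" and "y 1 \<in> A" "t \<in> {1..Suc T}"
  shows "y t \<in> A"
proof (cases "t = 1")
  case False
  then have "t = Suc (t - 1)" "t - 1 \<in> {1..T}" using assms(3) by auto
  then have "is_arg_min (\<lambda>a. \<eta> * (p (t - 1) \<bullet> a) + bregman h gh a (y (t - 1))) (\<lambda>a. a \<in> A) (y t)"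
    using md unfolding mirror_descent_def by metis
  then show ?thesis by (simp add: is_arg_min_def)
qed (use assms in simp)

text \<open>The comparator \<open>a\<close> is an approximate subgradient of \<open>f\<close> at the
  average \<open>?v\<close>: there \<open>a \<bullet> ?v\<close> minus the conjugate at
  \<open>a\<close> is within \<open>e / T\<close> of \<open>f ?v\<close>. For the iterates, the
  Young-Fenchel inequality bounds \<open>c \<bullet> y t\<close> by \<open>f c\<close> plus the
  conjugate at \<open>y t\<close>, which gives the claim for every fixed \<open>c\<close>. Of the
  constant 3 / 2, one unit is the initial Bregman distance and one half the accumulated squared
  steps.\<close>

lemma mirror_descent_regret:
  fixes f :: "'a::euclidean_space \<Rightarrow> real"
  assumes N: "is_norm N" and f: "convex_on UNIV f" "continuous_on UNIV f"
    and A: "A = conj_domain f" "is_gradient_on A h gh" "strongly_convex1_on A (dual_norm N) h"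
    and D: "D > 0" "\<And>a b. a \<in> A \<Longrightarrow> b \<in> A \<Longrightarrow> bregman h gh a b \<le> D" and G: "G > 0" and T: "T > 0"
    and md: "mirror_descent A f h gh (sqrt D / (G * sqrt (real T))) T v y p"
    and y1: "y 1 \<in> A" and p: "\<And>t. t \<in> {1..T} \<Longrightarrow> N (p t) \<le> G"
  shows "(\<Sum>t=1..T. (c - v t) \<bullet> y t)
    \<le> T * f c - T * f ((1 / real T) *\<^sub>R (\<Sum>t=1..T. v t)) + 3 / 2 * (sqrt D * G * sqrt T)"
    (is "_ \<le> _ - T * f ?v + _")
proof (rule field_le_epsilon)
  fix e :: real assume "e > 0"
  define \<eta> where "\<eta> = sqrt D / (G * sqrt (real T))"
  have \<eta>: "\<eta> > 0" using D G T by (simp add: \<eta>_def)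
  have \<eta>_mult: "\<eta> * (sqrt D * G * sqrt T) = D"
  proof -
    have "\<eta> * (sqrt D * G * sqrt T) = (sqrt D * sqrt D) * ((G * sqrt T) / (G * sqrt T))"
      by (simp add: \<eta>_def)
    also have "(G * sqrt T) / (G * sqrt T) = 1" using G T by simp
    finally show ?thesis using D by simp
  qed
  have \<eta>_sq: "T * (\<eta>\<^sup>2 * G\<^sup>2 / 2) = D / 2"
  proof -
    have "\<eta> * (G * sqrt T) = sqrt D" using G T by (simp add: \<eta>_def)
    then have "(\<eta> * (G * sqrt T))\<^sup>2 = D" using D by simp
    then show ?thesis by (simp add: power_mult_distrib mult_ac)
  qed
  have cvx: "convex A" unfolding A by (rule convex_conj_domain)
  have sub: "is_subgradient (\<lambda>a. ereal (- (v t \<bullet> a)) + fenchel_conj f a) (y t) (p t)"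
    and min: "is_arg_min (\<lambda>a. \<eta> * (p t \<bullet> a) + bregman h gh a (y t)) (\<lambda>a. a \<in> A) (y (Suc t))"
    if "t \<in> {1..T}" for t
    using md that by (auto simp: mirror_descent_def \<eta>_def)
  have yA: "y t \<in> A" if "t \<in> {1..Suc T}" for t
    by (rule mirror_descent_in[OF md y1 that])
  \<comment> \<open>The slack is incurred once per round, so each round gets an equal share of
    \<open>e\<close>.\<close>
  have "e / T > 0" using \<open>e > 0\<close> T by simp
  then obtain a where a: "\<And>x. f ?v + a \<bullet> (x - ?v) - e / T \<le> f x"
    using approx_subgradient[OF f, of "e / T" ?v] by blast
  have a': "a \<bullet> x - f x \<le> a \<bullet> ?v - f ?v + e / T" for x
    using a[of x] by (simp add: algebra_simps)
  have "a \<in> conj_domain f" by (rule conj_domainI) (rule a')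
  then obtain ca where ca: "fenchel_conj f a = ereal ca"
      and "\<forall>x. a \<bullet> x - f x \<le> ca" and "\<forall>b. (\<forall>x. a \<bullet> x - f x \<le> b) \<longrightarrow> ca \<le> b"
    by (rule fenchel_conj_real)
  then have ca_le: "ca \<le> a \<bullet> ?v - f ?v + e / T" using a' by blast
  have aA: "a \<in> A" unfolding A(1) by fact
  have step: "(c - v t) \<bullet> y t \<le> f c - v t \<bullet> a + ca + p t \<bullet> (y t - a)" if t: "t \<in> {1..T}" for t
  proof -
    have "y t \<in> conj_domain f" using yA[of t] t by (simp add: A(1))
    then obtain cy where cy: "fenchel_conj f (y t) = ereal cy" "\<forall>x. y t \<bullet> x - f x \<le> cy"
      by (rule fenchel_conj_real)
    have "ereal (- (v t \<bullet> y t)) + fenchel_conj f (y t) + ereal (p t \<bullet> (a - y t))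
        \<le> ereal (- (v t \<bullet> a)) + fenchel_conj f a"
      using sub[OF t] by (simp add: is_subgradient_def)
    then have "- (v t \<bullet> y t) + cy + p t \<bullet> (a - y t) \<le> - (v t \<bullet> a) + ca" by (simp add: ca cy)
    then show ?thesis using cy(2)[rule_format, of c] by (simp add: algebra_simps inner_commute)
  qed
  have "(\<Sum>t=1..n. \<eta> * (p t \<bullet> (y t - a))) \<le> bregman h gh a (y 1) - bregman h gh a (y (Suc n)) + n * (\<eta>\<^sup>2 * G\<^sup>2 / 2)"
    if "n \<le> T" for n
    using that
  proof (induction n)
    case (Suc n)
    have t: "Suc n \<in> {1..T}" using Suc by auto
    have "\<eta> * (p (Suc n) \<bullet> (y (Suc n) - a))
      \<le> bregman h gh a (y (Suc n)) - bregman h gh a (y (Suc (Suc n))) + \<eta>\<^sup>2 * G\<^sup>2 / 2"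
      by (rule mirror_descent_step[OF N cvx A(2,3) _ aA \<eta> p[OF t] min[OF t]]) (use t in \<open>auto intro: yA\<close>)
    then show ?case using Suc by (simp add: distrib_right add_divide_distrib)
  qed simp
  from this[of T] have "\<eta> * (\<Sum>t=1..T. p t \<bullet> (y t - a))
      \<le> bregman h gh a (y 1) - bregman h gh a (y (Suc T)) + T * (\<eta>\<^sup>2 * G\<^sup>2 / 2)"
    by (simp add: sum_distrib_left)
  also have "\<dots> \<le> D + T * (\<eta>\<^sup>2 * G\<^sup>2 / 2)"
  proof -
    have "0 \<le> 1 / 2 * (dual_norm N (a - y (Suc T)))\<^sup>2" by simp
    also have "\<dots> \<le> bregman h gh a (y (Suc T))" by (rule bregman_lower[OF cvx A(2,3) aA yA]) simp
    finally show ?thesis using D(2)[OF aA y1] by simp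
  qed
  also have "\<dots> = 3 / 2 * D"
    using \<eta>_sq by simp
  also have "\<dots> = \<eta> * (3 / 2 * (sqrt D * G * sqrt T))"
    using \<eta>_mult by simp
  finally have reg: "(\<Sum>t=1..T. p t \<bullet> (y t - a)) \<le> 3 / 2 * (sqrt D * G * sqrt T)"
    using \<eta> by (simp only: mult_le_cancel_left_pos)
  have "(\<Sum>t=1..T. (c - v t) \<bullet> y t) \<le> (\<Sum>t=1..T. f c - v t \<bullet> a + ca + p t \<bullet> (y t - a))"
    by (intro sum_mono step)
  also have "\<dots> = T * f c - (\<Sum>t=1..T. v t) \<bullet> a + T * ca + (\<Sum>t=1..T. p t \<bullet> (y t - a))"
    by (simp add: sum.distrib sum_subtractf inner_sum_left)
  also have "(\<Sum>t=1..T. v t) \<bullet> a = T * (a \<bullet> ?v)" using T by (simp add: inner_commute)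
  also have "T * ca \<le> T * (a \<bullet> ?v - f ?v + e / T)" by (intro mult_left_mono ca_le) simp
  also have "\<dots> = T * (a \<bullet> ?v) - T * f ?v + e" using T by (simp add: algebra_simps)
  finally show "(\<Sum>t=1..T. (c - v t) \<bullet> y t) \<le> T * f c - T * f ?v + 3 / 2 * (sqrt D * G * sqrt T) + e"
    using reg by simp
qed

section \<open>Convergence rates\<close>

text \<open>Comparison with the integral: by the mean value theorem the increment of x powr (1 - b)
  / (1 - b) over one unit step dominates the next summand. The step from 0 is separate, since the
  power is not differentiable there.\<close>

lemma sum_powr_le:
  fixes b :: real
  assumes "0 < b" "b < 1"
  shows "(\<Sum>n=1..T. real n powr - b) \<le> real T powr (1 - b) / (1 - b)"
proof (induction T)
  case (Suc T)
  have "real (Suc T) powr - b \<le> (real (Suc T) powr (1 - b) - real T powr (1 - b)) / (1 - b)"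
  proof (cases "T = 0")
    case True
    then show ?thesis using assms by simp
  next
    case False
    have "\<exists>z. real T < z \<and> z < real (Suc T) \<and> real (Suc T) powr (1 - b) - real T powr (1 - b)
        = (real (Suc T) - real T) * ((1 - b) * z powr (1 - b - 1))"
      by (rule MVT2) (use False in \<open>auto intro!: derivative_eq_intros\<close>)
    then obtain z where z: "real T < z" "z < real (Suc T)"
      "real (Suc T) powr (1 - b) - real T powr (1 - b) = (1 - b) * z powr - b" by auto
    have "real (Suc T) powr - b \<le> z powr - b"
      using z assms by (intro powr_mono2') auto
    then show ?thesis using z(3) assms by simp
  qed
  then show ?case using Suc by (simp add: diff_divide_distrib)
qed simp

text \<open>The sum stops at \<open>T - 1\<close> because the model of the last round is fitted to
  \<open>T - 1\<close> observations.\<close>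

lemma mean_powr_le:
  fixes b :: real
  assumes "0 < b" "b < 1" "T > 0"
  shows "(\<Sum>n=1..T - 1. real n powr - b) / T \<le> real T powr - b / (1 - b)"
proof -
  have "(\<Sum>n=1..T - 1. real n powr - b) \<le> (\<Sum>n=1..T. real n powr - b)"
    by (rule sum_mono2) auto
  also note sum_powr_le[OF assms(1,2)]
  finally have "(\<Sum>n=1..T - 1. real n powr - b) / T \<le> real T powr (1 - b) / (1 - b) / T"
    by (rule divide_right_mono) simp
  also have "\<dots> = real T powr - b / (1 - b)"
    using assms(3) by (simp add: powr_diff powr_minus divide_simps)
  finally show ?thesis .
qed

text \<open>
  For \<open>\<alpha> \<le> 1 / 2\<close> the mean of the \<open>n powr - \<alpha>\<close> is at most \<open>2 * T powr - \<alpha>\<close>; for larger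
  \<open>\<alpha>\<close>, where the constant would depend on \<open>\<alpha>\<close>, it is of smaller order than \<open>T powr (- 1 / 2)\<close>.
\<close>

lemma eventually_mean_rate_le:
  fixes \<alpha> \<kappa> s C :: real
  assumes "\<alpha> > 0" "\<kappa> > 0" "s > 0"
  shows "\<forall>\<^sub>F T in sequentially. (C + (\<Sum>n=1..T - 1. \<kappa> * real n powr - \<alpha>)) / T
    \<le> 2 * \<kappa> * real T powr - \<alpha> + s * real T powr (- 1 / 2)"
proof -
  \<comment> \<open>Above 1 / 2 the exponent is lowered to at most 3 / 4: below 1, so that the
    estimate of the mean applies, yet still above 1 / 2, so that the result is of smaller order than
    the square-root rate.\<close>
  define \<beta> where "\<beta> = (if \<alpha> \<le> 1 / 2 then \<alpha> else min \<alpha> (3 / 4))"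
  define K where "K = (if \<alpha> \<le> 1 / 2 then 0 else \<kappa> / (1 - \<beta>))"
  have \<beta>: "0 < \<beta>" "\<beta> < 1" "\<beta> \<le> \<alpha>" "\<alpha> > 1 / 2 \<Longrightarrow> \<beta> > 1 / 2" using assms by (auto simp: \<beta>_def)
  \<comment> \<open>These are the leftovers after factoring out T powr (- 1 / 2). For
    \<open>\<alpha> \<le> 1 / 2\<close> the coefficient \<open>K\<close> is 0 and the exponent -1 is
    just some negative value.\<close>
  have "((\<lambda>T. C * real T powr (- 1 / 2) + K * real T powr (if \<alpha> \<le> 1 / 2 then -1 else 1 / 2 - \<beta>))
      \<longlongrightarrow> C * 0 + K * 0) sequentially"
    by (intro tendsto_intros tendsto_neg_powr filterlim_real_sequentially) (use \<beta> in auto)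
  then have "\<forall>\<^sub>F T in sequentially.
      C * real T powr (- 1 / 2) + K * real T powr (if \<alpha> \<le> 1 / 2 then -1 else 1 / 2 - \<beta>) < s"
    using \<open>s > 0\<close> by (auto simp: order_tendsto_iff)
  with eventually_gt_at_top[of 0] show ?thesis
  proof eventually_elim
    case (elim T)
    have "(\<Sum>n=1..T - 1. real n powr - \<alpha>) \<le> (\<Sum>n=1..T - 1. real n powr - \<beta>)"
      by (intro sum_mono powr_mono) (use \<beta> in auto)
    then have "(\<Sum>n=1..T - 1. real n powr - \<alpha>) / T \<le> (\<Sum>n=1..T - 1. real n powr - \<beta>) / T"
      by (rule divide_right_mono) simp
    also have "\<dots> \<le> real T powr - \<beta> / (1 - \<beta>)" by (rule mean_powr_le) (use \<beta> elim in auto)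
    finally have 1: "\<kappa> * ((\<Sum>n=1..T - 1. real n powr - \<alpha>) / T) \<le> \<kappa> * (real T powr - \<beta> / (1 - \<beta>))"
      using assms by (intro mult_left_mono) auto
    have T: "1 / real T = real T powr (- 1 / 2) * real T powr (- 1 / 2)"
      using elim by (simp add: powr_add[symmetric] powr_minus_divide)
    have 2: "C / T + K * (real T powr - \<beta>) \<le> s * real T powr (- 1 / 2)"
    proof -
      have "C / T + K * (real T powr - \<beta>) = real T powr (- 1 / 2) *
          (C * real T powr (- 1 / 2) + K * real T powr (if \<alpha> \<le> 1 / 2 then -1 else 1 / 2 - \<beta>))"
        using T by (simp add: K_def distrib_left powr_add[symmetric] mult_ac)
      also have "\<dots> \<le> real T powr (- 1 / 2) * s" using elim by (intro mult_left_mono) auto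
      finally show ?thesis by (simp add: mult.commute)
    qed
    have 3: "\<kappa> * (real T powr - \<beta> / (1 - \<beta>)) \<le> 2 * \<kappa> * real T powr - \<alpha> + K * (real T powr - \<beta>)"
    proof (cases "\<alpha> \<le> 1 / 2")
      case True
      then have "real T powr - \<beta> / (1 - \<beta>) \<le> real T powr - \<beta> / (1 / 2)"
        by (intro divide_left_mono) (auto simp: \<beta>_def)
      then show ?thesis using True assms mult_left_mono[of _ _ \<kappa>] by (fastforce simp: K_def \<beta>_def)
    qed (use assms in \<open>simp add: K_def\<close>)
    have "(C + (\<Sum>n=1..T - 1. \<kappa> * real n powr - \<alpha>)) / T
        = C / T + \<kappa> * ((\<Sum>n=1..T - 1. real n powr - \<alpha>) / T)"
      by (simp add: sum_distrib_left[symmetric] add_divide_distrib)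
    then show ?case using 1 2 3 by linarith
  qed
qed

text \<open>The condition on \<open>\<zeta>\<close> says exactly that
  \<open>\<zeta> - \<zeta>'\<close> is at least
  \<open>\<zeta> / 2 + a / b + \<kappa> / (D * b)\<close>. Each summand of this margin pays for one
  kind of error: \<open>\<zeta> / 2\<close> for the terms with \<open>\<zeta> * b\<close>,
  \<open>a / b\<close> for those with \<open>a\<close>, and \<open>\<kappa> / (D * b)\<close> for
  \<open>\<kappa> * r\<close>, which is where the factor \<open>D * b\<close> of \<open>r\<close> in
  the conclusion originates.\<close>

lemma penalty_rate:
  fixes \<zeta> \<zeta>' \<delta> \<rho> D a b q r \<kappa> :: real
  assumes "D > 0" "a > 0" "b > 0" "\<kappa> > 0" "\<zeta> > 0" "\<rho> > 0" "q \<ge> 0" "r \<ge> 0"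
    and \<zeta>: "\<zeta> \<ge> 2 * (\<zeta>' + a / b + \<kappa> / (D * b))"
    and le: "\<zeta> * \<delta> \<le> \<zeta>' * \<delta> + (3 / 2 * \<rho> * (D * (\<zeta> * b + a)) * q + (2 * \<kappa> * r + \<rho> * D * \<zeta> * b * q))"
  shows "\<delta> \<le> 10 * \<rho> * (D * b) * q + 10 * (D * b) * r"
proof -
  let ?M = "\<zeta> / 2 + a / b + \<kappa> / (D * b)"
  have M: "?M \<le> \<zeta> - \<zeta>'" 
  proof -
    have "\<zeta> / 2 + x + y \<le> \<zeta> - \<zeta>'" if "2 * (\<zeta>' + x + y) \<le> \<zeta>" for x y :: real using that by simp
    then show ?thesis using \<zeta> .
  qed
  have pos: "?M > 0" using assms by (simp add: add_pos_pos)
  let ?E = "10 * \<rho> * (D * b) * q + 10 * (D * b) * r"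
  have E: "?E \<ge> 0" using assms by simp
  have "(\<zeta> - \<zeta>') * \<delta> \<le> 3 / 2 * \<rho> * (D * (\<zeta> * b + a)) * q + (2 * \<kappa> * r + \<rho> * D * \<zeta> * b * q)"
    using le by (simp add: algebra_simps)
  also have "\<dots> \<le> ?M * ?E"
  proof -
    have "?M * ?E = 5 * (\<rho> * D * \<zeta> * b * q) + 10 * (\<rho> * D * a * q) + 10 * (\<rho> * \<kappa> * q)
        + 5 * (\<zeta> * D * b * r) + 10 * (D * a * r) + 10 * (\<kappa> * r)"
      using assms by (simp add: field_simps)
    moreover have "\<rho> * D * \<zeta> * b * q \<ge> 0" "\<rho> * D * a * q \<ge> 0" "\<rho> * \<kappa> * q \<ge> 0" "\<zeta> * D * b * r \<ge> 0"
      "D * a * r \<ge> 0" "\<kappa> * r \<ge> 0" using assms by simp_all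
    moreover have "3 / 2 * \<rho> * (D * (\<zeta> * b + a)) * q = 3 / 2 * (\<rho> * D * \<zeta> * b * q) + 3 / 2 * (\<rho> * D * a * q)"
      by (simp add: algebra_simps)
    ultimately show ?thesis by linarith
  qed
  also have "\<dots> \<le> (\<zeta> - \<zeta>') * ?E" by (intro mult_right_mono M E)
  finally show ?thesis using M pos by (simp only: mult_le_cancel_left_pos[of "\<zeta> - \<zeta>'"])
qed

section \<open>Measurability and integrability of matrix expressions\<close>

lemma norm_matrix_vector_mult_le:
  fixes A :: "real ^ 'm ^ 'd"
  shows "norm (A *v x) \<le> norm A * norm x"
proof -
  have "norm (A *v x) = L2_set (\<lambda>i. \<bar>(A $ i) \<bullet> x\<bar>) UNIV"
    by (simp add: norm_vec_def matrix_vector_mul_component)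
  also have "\<dots> \<le> L2_set (\<lambda>i. norm (A $ i) * norm x) UNIV"
    by (intro L2_set_mono) (auto simp: Cauchy_Schwarz_ineq2)
  also have "\<dots> = norm A * norm x"
    by (simp add: norm_vec_def L2_set_left_distrib)
  finally show ?thesis .
qed

lemma bounded_bilinear_matrix_vector_mult:
  "bounded_bilinear ((*v) :: real ^ 'm ^ 'd \<Rightarrow> real ^ 'm \<Rightarrow> real ^ 'd)"
proof
  show "\<exists>K. \<forall>(A :: real ^ 'm ^ 'd) x. norm (A *v x) \<le> norm A * norm x * K"
    by (rule exI[of _ 1]) (simp add: norm_matrix_vector_mult_le)
qed (simp_all add: algebra_simps matrix_vector_mult_scaleR scaleR_matrix_vector_assoc)

lemma inner_transpose_matrix_vector_mult:
  fixes A :: "real ^ 'm ^ 'd"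
  shows "(transpose A *v a) \<bullet> y = a \<bullet> (A *v y)"
  by (simp add: dot_lmul_matrix)

lemma norm_transpose_matrix_vector_mult_le:
  fixes A :: "real ^ 'm ^ 'd"
  shows "norm (transpose A *v a) \<le> norm A * norm a"
proof -
  let ?y = "transpose A *v a"
  have "norm ?y * norm ?y = a \<bullet> (A *v ?y)"
    by (metis inner_transpose_matrix_vector_mult norm_eq_square power2_eq_square power2_norm_eq_inner)
  also have "\<dots> \<le> norm a * (norm A * norm ?y)"
    by (rule order_trans[OF norm_cauchy_schwarz]) (intro mult_left_mono norm_matrix_vector_mult_le norm_ge_zero)
  finally have "norm ?y * norm ?y \<le> (norm A * norm a) * norm ?y" by (simp add: mult_ac)
  then show ?thesis by (cases "norm ?y = 0") (simp_all add: mult_le_cancel_right)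
qed

text \<open>The adjoint identity reduces additivity and homogeneity in the matrix to the
  untransposed product. Besides measurability, bilinearity allows sums and integrals over decisions
  to be moved through the matrix.\<close>

lemma bounded_bilinear_transpose_matrix_vector_mult:
  "bounded_bilinear (\<lambda>(A :: real ^ 'm ^ 'd) a. transpose A *v a)"
proof
  show "\<exists>K. \<forall>(A :: real ^ 'm ^ 'd) x. norm (transpose A *v x) \<le> norm A * norm x * K"
    by (rule exI[of _ 1]) (simp add: norm_transpose_matrix_vector_mult_le del: transpose_matrix_vector)
next
  fix A B :: "real ^ 'm ^ 'd" and a and r :: real
  show "transpose (A + B) *v a = transpose A *v a + transpose B *v a"
    by (rule vector_eq_rdot[THEN iffD1])
      (simp add: inner_add_left inner_transpose_matrix_vector_mult inner_add_right algebra_simps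
        del: transpose_matrix_vector)
  show "transpose (r *\<^sub>R A) *v a = r *\<^sub>R (transpose A *v a)"
    by (rule vector_eq_rdot[THEN iffD1])
      (simp add: inner_transpose_matrix_vector_mult scaleR_matrix_vector_assoc[symmetric]
        del: transpose_matrix_vector)
qed (simp_all add: algebra_simps matrix_vector_mult_scaleR del: transpose_matrix_vector)

lemma borel_measurable_matrix_vector_mult [measurable (raw)]:
  fixes f :: "'a \<Rightarrow> real ^ 'm ^ 'd"
  assumes "f \<in> borel_measurable M" "g \<in> borel_measurable M"
  shows "(\<lambda>x. f x *v g x) \<in> borel_measurable M"
  by (rule borel_measurable_continuous_Pair[OF assms])
    (intro bounded_bilinear.continuous_on[OF bounded_bilinear_matrix_vector_mult] continuous_intros)

lemma borel_measurable_transpose_matrix_vector_mult [measurable (raw)]: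
  fixes f :: "'a \<Rightarrow> real ^ 'm ^ 'd"
  assumes "f \<in> borel_measurable M" "g \<in> borel_measurable M"
  shows "(\<lambda>x. transpose (f x) *v g x) \<in> borel_measurable M"
  by (rule borel_measurable_continuous_Pair[OF assms])
    (intro bounded_bilinear.continuous_on[OF bounded_bilinear_transpose_matrix_vector_mult] continuous_intros)

lemma borel_measurable_vec_nth [measurable (raw)]:
  fixes f :: "'a \<Rightarrow> 'b::{second_countable_topology, real_normed_vector} ^ 'm"
  assumes "f \<in> borel_measurable M"
  shows "(\<lambda>x. f x $ i) \<in> borel_measurable M"
  by (rule measurable_compose[OF assms borel_measurable_continuous_onI]) (intro continuous_intros)

lemma borel_measurable_fst_snd [measurable (raw)]:
  fixes f :: "'a \<Rightarrow> 'b::second_countable_topology \<times> 'c::second_countable_topology"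
  assumes "f \<in> borel_measurable M"
  shows "(\<lambda>x. fst (f x)) \<in> borel_measurable M" "(\<lambda>x. snd (f x)) \<in> borel_measurable M"
  by (rule measurable_compose[OF assms borel_measurable_continuous_onI], intro continuous_intros)+

lemma borel_measurable_coeff_vec [measurable (raw)]:
  fixes f :: "'a \<Rightarrow> ('d::finite, 'm::finite) outcome"
  assumes [measurable]: "f \<in> borel_measurable M" "g \<in> borel_measurable M"
  shows "(\<lambda>x. coeff_vec \<zeta> (f x) (g x)) \<in> borel_measurable M"
  unfolding coeff_vec_def by measurable

text \<open>The dual pair enters only through the combination \<lambda> + \<zeta> \<theta>, so a
  single bound on that vector controls the Lagrangian reward.\<close>

lemma coeff_vec_eq: "coeff_vec \<zeta> \<mu> \<omega> = fst \<mu> - snd \<mu> *v (fst \<omega> + \<zeta> *\<^sub>R snd \<omega>)"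
  by (simp add: coeff_vec_def matrix_vector_right_distrib matrix_vector_mult_scaleR)

lemma inner_coeff_vec:
  "coeff_vec \<zeta> \<mu> \<omega> \<bullet> a = fst \<mu> \<bullet> a - (transpose (snd \<mu>) *v a) \<bullet> (fst \<omega> + \<zeta> *\<^sub>R snd \<omega>)"
  unfolding coeff_vec_eq inner_diff_left inner_transpose_matrix_vector_mult by (simp add: inner_commute)

text \<open>Each summand is a factor built from decision and dual pair times one component of the
  outcome, the form to which the componentwise conditional mean applies.\<close>

lemma inner_coeff_vec_sum:
  "coeff_vec \<zeta> \<mu> \<omega> \<bullet> a = (\<Sum>i\<in>UNIV. a $ i * fst \<mu> $ i)
     - (\<Sum>i\<in>UNIV. \<Sum>j\<in>UNIV. (a $ i * (fst \<omega> + \<zeta> *\<^sub>R snd \<omega>) $ j) * snd \<mu> $ i $ j)"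
  unfolding coeff_vec_eq
  by (simp add: inner_vec_def matrix_vector_mult_def sum_distrib_left right_diff_distrib
      left_diff_distrib sum_subtractf mult_ac)

lemma norm_coeff_vec_le:
  assumes "norm (fst \<omega> + \<zeta> *\<^sub>R snd \<omega>) \<le> B"
  shows "norm (coeff_vec \<zeta> \<mu> \<omega>) \<le> norm (fst \<mu>) + norm (snd \<mu>) * B"
proof -
  have "norm (coeff_vec \<zeta> \<mu> \<omega>) \<le> norm (fst \<mu>) + norm (snd \<mu> *v (fst \<omega> + \<zeta> *\<^sub>R snd \<omega>))"
    unfolding coeff_vec_eq by (rule norm_triangle_ineq4)
  also have "norm (snd \<mu> *v (fst \<omega> + \<zeta> *\<^sub>R snd \<omega>)) \<le> norm (snd \<mu>) * B"
    by (rule order_trans[OF norm_matrix_vector_mult_le]) (intro mult_left_mono assms norm_ge_zero)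
  finally show ?thesis by simp
qed

section \<open>Integrals over i.i.d. samples\<close>

text \<open>Otherwise a hyperplane would strictly separate the integral from \<open>S\<close>, and
  integrating the separating inequality contradicts this. The lemma keeps averaged decisions inside
  the decision set.\<close>

lemma (in prob_space) integral_in_closed_convex:
  fixes f :: "'a \<Rightarrow> 'b::euclidean_space"
  assumes "convex S" "closed S" and f: "integrable M f" "\<And>x. x \<in> space M \<Longrightarrow> f x \<in> S"
  shows "(\<integral>x. f x \<partial>M) \<in> S"
proof (rule ccontr)
  assume "(\<integral>x. f x \<partial>M) \<notin> S"
  from separating_hyperplane_closed_point[OF assms(1,2) this]
  obtain a b where ab: "a \<bullet> (\<integral>x. f x \<partial>M) < b" "\<And>x. x \<in> S \<Longrightarrow> b < a \<bullet> x" by blast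
  have "(\<integral>x. b \<partial>M) \<le> (\<integral>x. a \<bullet> f x \<partial>M)"
    by (intro integral_mono) (use f ab(2) in \<open>auto intro: less_imp_le\<close>)
  then show False using ab(1) f(1) by (simp add: prob_space)
qed

lemma (in prob_space) PiM_prob_space: "prob_space (PiM I (\<lambda>_. M))"
  by (intro prob_space_PiM prob_space_axioms)

text \<open>A fresh observation is independent of the past. Coordinates beyond \<open>Suc n\<close>
  are projected away; the remaining ones are rebuilt by inserting the new observation into a past
  sequence, and splitting inverts this insertion on extensional functions.\<close>

lemma (in prob_space) distr_PiM_last:
  assumes "n < T"
  shows "(\<lambda>z. (z (Suc n), restrict z {1..n})) \<in> PiM {1..T} (\<lambda>_. M) \<rightarrow>\<^sub>M M \<Otimes>\<^sub>M PiM {1..n} (\<lambda>_. M)"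
    and "distr (PiM {1..T} (\<lambda>_. M)) (M \<Otimes>\<^sub>M PiM {1..n} (\<lambda>_. M)) (\<lambda>z. (z (Suc n), restrict z {1..n}))
      = M \<Otimes>\<^sub>M PiM {1..n} (\<lambda>_. M)"
proof -
  have prob_M: "prob_space M" by (rule prob_space_axioms)
  interpret product_prob_space "\<lambda>_::nat. M" "UNIV" ..
  let ?P = "\<lambda>k. PiM {1..k} (\<lambda>_::nat. M)"
  let ?f = "\<lambda>z. (z (Suc n), restrict z {1..n})"
  have sub: "{1..Suc n} \<subseteq> {1..T}" using assms by auto
  show meas: "?f \<in> ?P T \<rightarrow>\<^sub>M M \<Otimes>\<^sub>M ?P n"
    using assms by (intro measurable_Pair measurable_component_singleton measurable_restrict_subset) auto
  have meas': "?f \<in> ?P (Suc n) \<rightarrow>\<^sub>M M \<Otimes>\<^sub>M ?P n"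
    by (intro measurable_Pair measurable_component_singleton measurable_restrict_subset) auto
  have upd: "(\<lambda>(x, X). X(Suc n := x)) \<in> M \<Otimes>\<^sub>M ?P n \<rightarrow>\<^sub>M ?P (Suc n)"
  proof -
    have "(\<lambda>p. (snd p)(Suc n := fst p)) \<in> M \<Otimes>\<^sub>M ?P n \<rightarrow>\<^sub>M PiM (insert (Suc n) {1..n}) (\<lambda>_. M)"
      by (intro measurable_fun_upd[where J = "{1..n}"]) auto
    also have "insert (Suc n) {1..n} = {1..Suc n}" by auto
    finally show ?thesis unfolding case_prod_beta' .
  qed
  have "distr (?P T) (M \<Otimes>\<^sub>M ?P n) ?f
      = distr (?P T) (M \<Otimes>\<^sub>M ?P n) (?f \<circ> (\<lambda>z. restrict z {1..Suc n}))"
    by (intro distr_cong) (auto simp: restrict_def)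
  also have "\<dots> = distr (distr (?P T) (?P (Suc n)) (\<lambda>z. restrict z {1..Suc n})) (M \<Otimes>\<^sub>M ?P n) ?f"
    by (intro distr_distr[symmetric] meas' measurable_restrict_subset sub)
  also have "distr (?P T) (?P (Suc n)) (\<lambda>z. restrict z {1..Suc n}) = ?P (Suc n)"
    by (rule distr_restrict[symmetric]) (use sub in auto)
  also have "?P (Suc n) = distr (M \<Otimes>\<^sub>M ?P n) (?P (Suc n)) (\<lambda>(x, X). X(Suc n := x))"
    using distr_pair_PiM_eq_PiM[of "{1..n}" "\<lambda>_. M" "Suc n"] prob_M
    by (simp add: atLeastAtMostSuc_conv)
  also have "distr \<dots> (M \<Otimes>\<^sub>M ?P n) ?f = distr (M \<Otimes>\<^sub>M ?P n) (M \<Otimes>\<^sub>M ?P n) (?f \<circ> (\<lambda>(x, X). X(Suc n := x)))"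
    by (intro distr_distr meas' upd)
  also have "\<dots> = distr (M \<Otimes>\<^sub>M ?P n) (M \<Otimes>\<^sub>M ?P n) (\<lambda>p. p)"
  proof (intro distr_cong refl)
    fix p assume "p \<in> space (M \<Otimes>\<^sub>M ?P n)"
    then have "snd p \<in> extensional {1..n}" by (auto simp: space_pair_measure space_PiM PiE_def)
    then show "(?f \<circ> (\<lambda>(x, X). X(Suc n := x))) p = p"
      by (cases p) (auto simp: restrict_def extensional_def fun_eq_iff)
  qed
  also have "\<dots> = M \<Otimes>\<^sub>M ?P n" by simp
  finally show "distr (?P T) (M \<Otimes>\<^sub>M ?P n) ?f = M \<Otimes>\<^sub>M ?P n" .
qed

lemma (in prob_space) PiM_last_integral:
  fixes f :: "'a \<times> (nat \<Rightarrow> 'a) \<Rightarrow> 'b::{banach, second_countable_topology}"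
  assumes "n < T" and f: "integrable (M \<Otimes>\<^sub>M PiM {1..n} (\<lambda>_. M)) f"
  shows "integrable (PiM {1..T} (\<lambda>_. M)) (\<lambda>z. f (z (Suc n), restrict z {1..n}))"
    "(\<integral>z. f (z (Suc n), restrict z {1..n}) \<partial>PiM {1..T} (\<lambda>_. M)) = (\<integral>x. f x \<partial>(M \<Otimes>\<^sub>M PiM {1..n} (\<lambda>_. M)))"
proof -
  note d = distr_PiM_last[OF assms(1)]
  have m: "f \<in> borel_measurable (M \<Otimes>\<^sub>M PiM {1..n} (\<lambda>_. M))" using f by simp
  show "integrable (PiM {1..T} (\<lambda>_. M)) (\<lambda>z. f (z (Suc n), restrict z {1..n}))"
    using integrable_distr[OF d(1), of f] f unfolding d(2) by blast
  show "(\<integral>z. f (z (Suc n), restrict z {1..n}) \<partial>PiM {1..T} (\<lambda>_. M)) = (\<integral>x. f x \<partial>(M \<Otimes>\<^sub>M PiM {1..n} (\<lambda>_. M)))"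
    using integral_distr[OF d(1) m] unfolding d(2) by simp
qed

lemma integrable_pair_fst:
  fixes f :: "'a \<Rightarrow> 'c::{banach, second_countable_topology}"
  assumes "prob_space N" "integrable M f"
  shows "integrable (M \<Otimes>\<^sub>M N) (\<lambda>p. f (fst p))"
proof -
  have "integrable (distr (M \<Otimes>\<^sub>M N) M fst) f"
    by (simp add: prob_space.distr_pair_fst[OF assms(1)] assms(2))
  then show ?thesis by (rule integrable_distr[rotated]) simp
qed

text \<open>A Lipschitz function grows at most linearly, so an affine function of the Euclidean norm
  of \<open>g\<close> dominates the composition.\<close>

lemma (in prob_space) lipschitz_integrable:
  fixes g :: "'a \<Rightarrow> 'b::euclidean_space" and f :: "'b \<Rightarrow> real"
  assumes "is_norm N" and f: "\<And>a b. \<bar>f a - f b\<bar> \<le> L * N (a - b)" and g: "integrable M g"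
  shows "integrable M (\<lambda>x. f (g x))"
proof -
  obtain C where C: "C > 0" "\<And>x. N x \<le> C * norm x" using norm_le_euclidean[OF assms(1)] by blast
  have "integrable M (\<lambda>x. \<bar>f 0\<bar> + \<bar>L\<bar> * (C * norm (g x)))" using g by simp
  then show ?thesis
  proof (rule Bochner_Integration.integrable_bound)
    show "(\<lambda>x. f (g x)) \<in> borel_measurable M"
      by (rule measurable_compose[OF borel_measurable_integrable[OF g]])
        (rule borel_measurable_continuous_onI[OF lipschitz_continuous_on[OF assms(1) f]])
    show "AE x in M. norm (f (g x)) \<le> norm (\<bar>f 0\<bar> + \<bar>L\<bar> * (C * norm (g x)))"
    proof (rule AE_I2)
      fix x
      have "L * N (g x) \<le> \<bar>L\<bar> * (C * norm (g x))"
        by (intro mult_mono) (auto simp: C is_normD[OF assms(1)])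
      then show "norm (f (g x)) \<le> norm (\<bar>f 0\<bar> + \<bar>L\<bar> * (C * norm (g x)))" using f[of "g x" 0] by simp
    qed
  qed
qed

lemma (in prob_space) integral_affine:
  fixes f g :: "'a \<Rightarrow> real"
  assumes "integrable M f" "integrable M g"
  shows "(\<integral>x. a * f x - a * (b * g x) + c \<partial>M) = a * (\<integral>x. f x \<partial>M) - a * (b * (\<integral>x. g x \<partial>M)) + c"
  using assms by (simp add: prob_space)

text \<open>An affine minorant that is exact up to \<open>e\<close> at the mean is integrated; its
  linear part integrates to zero.\<close>

lemma (in prob_space) jensen_euclidean:
  fixes g :: "'a \<Rightarrow> 'b::euclidean_space" and f :: "'b \<Rightarrow> real"
  assumes f: "convex_on UNIV f" "continuous_on UNIV f"
    and g: "integrable M g" "integrable M (\<lambda>x. f (g x))"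
  shows "f (\<integral>x. g x \<partial>M) \<le> (\<integral>x. f (g x) \<partial>M)"
proof (rule field_le_epsilon)
  fix e :: real assume "e > 0"
  let ?v = "\<integral>x. g x \<partial>M"
  obtain p where p: "\<And>y. f ?v + p \<bullet> (y - ?v) - e \<le> f y"
    using approx_subgradient[OF f \<open>e > 0\<close>, of ?v] by blast
  have int: "integrable M (\<lambda>x. p \<bullet> (g x - ?v))" using g(1) by simp
  have "f ?v - e = (\<integral>x. f ?v + p \<bullet> (g x - ?v) - e \<partial>M)"
    using g(1) int by (simp add: prob_space)
  also have "\<dots> \<le> (\<integral>x. f (g x) \<partial>M)"
    by (intro integral_mono g p) (use int in simp)
  finally show "f ?v \<le> (\<integral>x. f (g x) \<partial>M) + e" by simp
qed


section \<open>One round of the algorithm\<close>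

text \<open>Utility, norm and constraint set do not appear: a single round only involves the
  Lagrangian reward. \<open>K\<close> bounds the decisions and \<open>B\<close> the combined dual
  vectors, so that multiples of the norms of reward and consumption matrix dominate the
  integrands.\<close>

locale decision_problem = prob_space P
  for P :: "('p::finite, 'd::finite, 'm::finite) obs measure" +
  fixes X :: "(real ^ 'p) set" and S :: "(real ^ 'd) set" and \<Lambda> \<Theta> :: "(real ^ 'm) set"
    and \<zeta> :: real
    and wstar :: "('d, 'm) outcome \<Rightarrow> (real ^ 'm) \<times> (real ^ 'm) \<Rightarrow> real ^ 'd"
    and gstar :: "real ^ 'p \<Rightarrow> ('d, 'm) outcome"
    and K B :: real
  assumes sets_P [measurable_cong]: "sets P = sets (context_space X \<Otimes>\<^sub>M borel)"
    and integrable_r: "integrable P (\<lambda>z. fst (snd z))"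
    and integrable_V: "integrable P (\<lambda>z. snd (snd z))"
    and convex_S: "convex S" and closed_S: "closed S" and S_le: "\<And>a. a \<in> S \<Longrightarrow> norm a \<le> K"
    and K_nonneg: "K \<ge> 0" and B_nonneg: "B \<ge> 0"
    and dual_le: "\<And>a b. a \<in> \<Lambda> \<Longrightarrow> b \<in> \<Theta> \<Longrightarrow> norm (a + \<zeta> *\<^sub>R b) \<le> B"
    and wstar_max: "\<And>\<mu> \<omega>. \<omega> \<in> \<Lambda> \<times> \<Theta> \<Longrightarrow>
          is_arg_max (\<lambda>a. coeff_vec \<zeta> \<mu> \<omega> \<bullet> a) (\<lambda>a. a \<in> S) (wstar \<mu> \<omega>)"
    and wstar_measurable: "(\<lambda>(\<mu>, \<omega>). wstar \<mu> \<omega>) \<in> borel_measurable borel"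
    and gstar: "is_cond_mean X P gstar"
begin

lemma space_P: "space P = X \<times> UNIV"
  using sets_eq_imp_space_eq[OF sets_P] by (simp add: space_pair_measure space_restrict_space)

lemma measurable_P [measurable]:
  "fst \<in> P \<rightarrow>\<^sub>M context_space X" "snd \<in> borel_measurable P"
  by measurable

lemma wstar_meas [measurable (raw)]:
  assumes "f \<in> borel_measurable M" "g \<in> borel_measurable M"
  shows "(\<lambda>x. wstar (f x) (g x)) \<in> borel_measurable M"
  using measurable_compose[OF borel_measurable_Pair[OF assms] wstar_measurable] by simp

lemma wstar_in_S: "\<omega> \<in> \<Lambda> \<times> \<Theta> \<Longrightarrow> wstar \<mu> \<omega> \<in> S"
  using wstar_max[of \<omega> \<mu>] by (simp add: is_arg_max_def)

lemma wstar_ge: "\<omega> \<in> \<Lambda> \<times> \<Theta> \<Longrightarrow> a \<in> S \<Longrightarrow> coeff_vec \<zeta> \<mu> \<omega> \<bullet> a \<le> coeff_vec \<zeta> \<mu> \<omega> \<bullet> wstar \<mu> \<omega>"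
  using wstar_max[of \<omega> \<mu>] by (auto simp: is_arg_max_def not_less)

lemma integrable_reward_bound: "integrable P (\<lambda>z. norm (fst (snd z)) * c + norm (snd (snd z)) * d)"
  using integrable_r integrable_V by auto

lemma inner_coeff_vec_le:
  assumes "\<omega> \<in> \<Lambda> \<times> \<Theta>" "norm a \<le> K"
  shows "\<bar>coeff_vec \<zeta> \<mu> \<omega> \<bullet> a\<bar> \<le> norm (fst \<mu>) * K + norm (snd \<mu>) * (B * K)"
proof -
  have "norm (coeff_vec \<zeta> \<mu> \<omega>) \<le> norm (fst \<mu>) + norm (snd \<mu>) * B"
    by (rule norm_coeff_vec_le) (use assms(1) dual_le in auto)
  then have "norm (coeff_vec \<zeta> \<mu> \<omega>) * norm a \<le> (norm (fst \<mu>) + norm (snd \<mu>) * B) * K"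
    using assms(2) K_nonneg B_nonneg by (intro mult_mono) auto
  then show ?thesis using Cauchy_Schwarz_ineq2[of "coeff_vec \<zeta> \<mu> \<omega>" a] by (simp add: algebra_simps)
qed

lemma integrable_coeff_vec:
  assumes "\<omega> \<in> \<Lambda> \<times> \<Theta>" "f \<in> borel_measurable P" "\<And>z. z \<in> space P \<Longrightarrow> f z \<in> S"
  shows "integrable P (\<lambda>z. coeff_vec \<zeta> (snd z) \<omega> \<bullet> f z)"
proof (rule Bochner_Integration.integrable_bound[OF integrable_reward_bound])
  show "(\<lambda>z. coeff_vec \<zeta> (snd z) \<omega> \<bullet> f z) \<in> borel_measurable P" using assms(2) by measurable
  show "AE z in P. norm (coeff_vec \<zeta> (snd z) \<omega> \<bullet> f z)
      \<le> norm (norm (fst (snd z)) * K + norm (snd (snd z)) * (B * K))"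
  proof (rule AE_I2)
    fix z assume "z \<in> space P"
    from inner_coeff_vec_le[OF assms(1) S_le[OF assms(3)[OF this]], of "snd z"]
    show "norm (coeff_vec \<zeta> (snd z) \<omega> \<bullet> f z)
        \<le> norm (norm (fst (snd z)) * K + norm (snd (snd z)) * (B * K))"
      unfolding real_norm_def by (rule order_trans[OF _ abs_ge_self])
  qed
qed

lemma subalg: "sigma_finite_subalgebra P (vimage_algebra (space P) fst (context_space X))"
proof (rule finite_measure_subalgebra_is_sigma_finite)
  have "subalgebra P (vimage_algebra (space P) fst (context_space X))"
    using sets_image_in_sets[OF refl measurable_P(1)] by (simp add: subalgebra_def)
  then show "finite_measure_subalgebra P (vimage_algebra (space P) fst (context_space X))"
    by unfold_locales
qed

text \<open>Pull-out property of conditional expectation, for a version \<open>gs\<close> that is a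
  function of the context. Boundedness of \<open>b\<close> keeps the products integrable.\<close>

lemma cond_mean_integral:
  fixes h :: "('p, 'd, 'm) obs \<Rightarrow> real"
  assumes b: "b \<in> borel_measurable (context_space X)" "\<And>x. x \<in> X \<Longrightarrow> \<bar>b x\<bar> \<le> C"
    and h: "integrable P h"
    and gs: "gs \<in> borel_measurable (context_space X)"
      "AE z in P. gs (fst z) = real_cond_exp P (vimage_algebra (space P) fst (context_space X)) h z"
  shows "integrable P (\<lambda>z. b (fst z) * h z)" "integrable P (\<lambda>z. b (fst z) * gs (fst z))"
    "(\<integral>z. b (fst z) * gs (fst z) \<partial>P) = (\<integral>z. b (fst z) * h z \<partial>P)"
proof -
  let ?F = "vimage_algebra (space P) fst (context_space X)"
  interpret F: sigma_finite_subalgebra P ?F by (rule subalg)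
  have bF: "(\<lambda>z. b (fst z)) \<in> borel_measurable ?F"
    by (rule measurable_compose[OF measurable_vimage_algebra1 b(1)]) (auto simp: space_P space_restrict_space)
  have [measurable]: "(\<lambda>z. b (fst z)) \<in> borel_measurable P" "(\<lambda>z. gs (fst z)) \<in> borel_measurable P"
    using b(1) gs(1) by measurable
  have [measurable]: "h \<in> borel_measurable P" using h by simp
  show i: "integrable P (\<lambda>z. b (fst z) * h z)"
  proof (rule Bochner_Integration.integrable_bound[OF integrable_mult_right[OF h, of C]])
    show "AE z in P. norm (b (fst z) * h z) \<le> norm (C * h z)"
    proof (rule AE_I2)
      fix z assume "z \<in> space P"
      then have "\<bar>b (fst z)\<bar> \<le> \<bar>C\<bar>" using b(2)[of "fst z"] by (auto simp: space_P)
      then show "norm (b (fst z) * h z) \<le> norm (C * h z)" by (simp add: abs_mult mult_right_mono)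
    qed
  qed measurable
  note c = F.real_cond_exp_intg[OF i bF]
  have ae: "AE z in P. b (fst z) * gs (fst z) = b (fst z) * real_cond_exp P ?F h z"
    using gs(2) by eventually_elim simp
  have [measurable]: "real_cond_exp P ?F h \<in> borel_measurable P" by (rule borel_measurable_cond_exp2)
  show "integrable P (\<lambda>z. b (fst z) * gs (fst z))"
    using c(1) by (subst integrable_cong_AE[OF _ _ ae]) auto
  have "(\<integral>z. b (fst z) * gs (fst z) \<partial>P) = (\<integral>z. b (fst z) * real_cond_exp P ?F h z \<partial>P)"
    by (rule integral_cong_AE[OF _ _ ae]) measurable
  also have "\<dots> = (\<integral>z. b (fst z) * h z \<partial>P)" by (rule c(2)) measurable
  finally show "(\<integral>z. b (fst z) * gs (fst z) \<partial>P) = (\<integral>z. b (fst z) * h z \<partial>P)" .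
qed

lemma gstar_measurable [measurable]: "gstar \<in> borel_measurable (context_space X)"
  using gstar by (simp add: is_cond_mean_def)

text \<open>The Lagrangian reward is linear in the outcome and \<open>f\<close> depends on the
  context alone, so the outcome may be exchanged for its conditional mean, one component at a
  time.\<close>

lemma gstar_integral:
  assumes f: "f \<in> borel_measurable (context_space X)" "\<And>x. x \<in> X \<Longrightarrow> f x \<in> S"
  shows "integrable P (\<lambda>z. coeff_vec \<zeta> (gstar (fst z)) \<omega> \<bullet> f (fst z))"
    "(\<integral>z. coeff_vec \<zeta> (gstar (fst z)) \<omega> \<bullet> f (fst z) \<partial>P) = (\<integral>z. coeff_vec \<zeta> (snd z) \<omega> \<bullet> f (fst z) \<partial>P)"
proof -
  let ?F = "vimage_algebra (space P) fst (context_space X)"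
  let ?y = "fst \<omega> + \<zeta> *\<^sub>R snd \<omega>"
  have f_le: "\<bar>f x $ i\<bar> \<le> K" if "x \<in> X" for x i
    using component_le_norm_cart[of "f x" i] S_le[OF f(2)[OF that]] by simp
  have fy_le: "\<bar>f x $ i * ?y $ j\<bar> \<le> K * \<bar>?y $ j\<bar>" if "x \<in> X" for x i j
    using f_le[OF that] by (simp add: abs_mult mult_right_mono)
  have hr: "integrable P (\<lambda>z. fst (snd z) $ i)" for i
    by (rule integrable_bounded_linear[OF bounded_linear_vec_nth integrable_r])
  have hV: "integrable P (\<lambda>z. snd (snd z) $ i $ j)" for i j
    by (rule integrable_bounded_linear[OF bounded_linear_vec_nth])
      (rule integrable_bounded_linear[OF bounded_linear_vec_nth integrable_V])
  have gr: "AE z in P. fst (gstar (fst z)) $ i = real_cond_exp P ?F (\<lambda>z. fst (snd z) $ i) z" for i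
    using gstar by (simp add: is_cond_mean_def Let_def case_prod_beta')
  have gV: "AE z in P. snd (gstar (fst z)) $ i $ j = real_cond_exp P ?F (\<lambda>z. snd (snd z) $ i $ j) z" for i j
    using gstar by (simp add: is_cond_mean_def Let_def case_prod_beta')
  have [measurable]: "f \<in> borel_measurable (context_space X)" by fact
  note R = cond_mean_integral[OF _ f_le hr _ gr]
  note V = cond_mean_integral[OF _ fy_le hV _ gV]
  have Ri: "integrable P (\<lambda>z. f (fst z) $ i * fst (snd z) $ i)"
    "integrable P (\<lambda>z. f (fst z) $ i * fst (gstar (fst z)) $ i)"
    "(\<integral>z. f (fst z) $ i * fst (gstar (fst z)) $ i \<partial>P) = (\<integral>z. f (fst z) $ i * fst (snd z) $ i \<partial>P)" for i
    by (rule R; measurable)+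
  have Vi: "integrable P (\<lambda>z. f (fst z) $ i * ?y $ j * snd (snd z) $ i $ j)"
    "integrable P (\<lambda>z. f (fst z) $ i * ?y $ j * snd (gstar (fst z)) $ i $ j)"
    "(\<integral>z. f (fst z) $ i * ?y $ j * snd (gstar (fst z)) $ i $ j \<partial>P)
      = (\<integral>z. f (fst z) $ i * ?y $ j * snd (snd z) $ i $ j \<partial>P)" for i j
    by (rule V; measurable)+
  show "integrable P (\<lambda>z. coeff_vec \<zeta> (gstar (fst z)) \<omega> \<bullet> f (fst z))"
    unfolding inner_coeff_vec_sum
    by (intro Bochner_Integration.integrable_diff Bochner_Integration.integrable_sum Ri Vi)
  show "(\<integral>z. coeff_vec \<zeta> (gstar (fst z)) \<omega> \<bullet> f (fst z) \<partial>P) = (\<integral>z. coeff_vec \<zeta> (snd z) \<omega> \<bullet> f (fst z) \<partial>P)"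
    unfolding inner_coeff_vec_sum
    by (simp only: Bochner_Integration.integral_diff Bochner_Integration.integral_sum
        Bochner_Integration.integrable_sum Ri Vi)
qed

lemma policy_integrals:
  assumes "\<pi> \<in> policies X S"
  shows "integrable P (\<lambda>z. fst (snd z) \<bullet> \<pi> (fst z))"
    "integrable P (\<lambda>z. transpose (snd (snd z)) *v \<pi> (fst z))"
    "rew P \<pi> = (\<integral>z. fst (snd z) \<bullet> \<pi> (fst z) \<partial>P)"
    "con P \<pi> = (\<integral>z. transpose (snd (snd z)) *v \<pi> (fst z) \<partial>P)"
proof -
  have [measurable]: "\<pi> \<in> borel_measurable (context_space X)" and le: "\<And>z. z \<in> space P \<Longrightarrow> norm (\<pi> (fst z)) \<le> K"
    using assms S_le by (auto simp: policies_def space_P)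
  show "integrable P (\<lambda>z. fst (snd z) \<bullet> \<pi> (fst z))"
  proof (rule Bochner_Integration.integrable_bound[OF integrable_mult_left[OF integrable_norm[OF integrable_r], of K]])
    show "AE z in P. norm (fst (snd z) \<bullet> \<pi> (fst z)) \<le> norm (norm (fst (snd z)) * K)"
      using le K_nonneg by (intro AE_I2) (auto intro!: order_trans[OF Cauchy_Schwarz_ineq2] mult_left_mono)
  qed measurable
  show "integrable P (\<lambda>z. transpose (snd (snd z)) *v \<pi> (fst z))"
  proof (rule Bochner_Integration.integrable_bound[OF integrable_mult_left[OF integrable_norm[OF integrable_V], of K]])
    show "AE z in P. norm (transpose (snd (snd z)) *v \<pi> (fst z)) \<le> norm (norm (snd (snd z)) * K)"
      using le K_nonneg
      by (intro AE_I2) (auto intro!: order_trans[OF norm_transpose_matrix_vector_mult_le] mult_left_mono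
        simp del: transpose_matrix_vector)
  qed measurable
qed (simp_all add: rew_def con_def case_prod_beta')

text \<open>The first integral, the reward of a decision that knows the outcome, does not involve
  \<open>G\<close> and cancels in the excess risk.\<close>

lemma spo_risk_eq:
  assumes "\<omega> \<in> \<Lambda> \<times> \<Theta>" and [measurable]: "G \<in> borel_measurable (context_space X)"
  shows "spo_risk P wstar \<zeta> G \<omega> = (\<integral>z. coeff_vec \<zeta> (snd z) \<omega> \<bullet> wstar (snd z) \<omega> \<partial>P)
    - (\<integral>z. coeff_vec \<zeta> (snd z) \<omega> \<bullet> wstar (G (fst z)) \<omega> \<partial>P)"
  unfolding spo_risk_def spo_loss_def case_prod_beta' inner_diff_right
  by (intro Bochner_Integration.integral_diff integrable_coeff_vec wstar_in_S assms) measurable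

text \<open>
  The prediction error is charged to the excess risk; the optimal prediction \<open>gstar\<close> may be
  replaced by the outcome itself inside the integral, so that its decision beats every policy.
\<close>

lemma policy_le_decision:
  assumes \<omega>: "\<omega> \<in> \<Lambda> \<times> \<Theta>" and [measurable]: "G \<in> borel_measurable (context_space X)"
    and \<pi>: "\<pi> \<in> policies X S"
  shows "rew P \<pi> - con P \<pi> \<bullet> (fst \<omega> + \<zeta> *\<^sub>R snd \<omega>)
    \<le> (\<integral>z. coeff_vec \<zeta> (snd z) \<omega> \<bullet> wstar (G (fst z)) \<omega> \<partial>P)
      + (spo_risk P wstar \<zeta> G \<omega> - spo_risk P wstar \<zeta> gstar \<omega>)"
proof -
  have [measurable]: "\<pi> \<in> borel_measurable (context_space X)" and \<pi>S: "\<And>x. x \<in> X \<Longrightarrow> \<pi> x \<in> S"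
    using \<pi> by (auto simp: policies_def)
  have wg: "(\<lambda>x. wstar (gstar x) \<omega>) \<in> borel_measurable (context_space X)" by measurable
  have "rew P \<pi> - con P \<pi> \<bullet> (fst \<omega> + \<zeta> *\<^sub>R snd \<omega>) = (\<integral>z. coeff_vec \<zeta> (snd z) \<omega> \<bullet> \<pi> (fst z) \<partial>P)"
    unfolding inner_coeff_vec using policy_integrals[OF \<pi>] by simp
  also have "\<dots> = (\<integral>z. coeff_vec \<zeta> (gstar (fst z)) \<omega> \<bullet> \<pi> (fst z) \<partial>P)"
    by (rule gstar_integral(2)[symmetric]) (use \<pi>S in auto)
  also have "\<dots> \<le> (\<integral>z. coeff_vec \<zeta> (gstar (fst z)) \<omega> \<bullet> wstar (gstar (fst z)) \<omega> \<partial>P)"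
    by (intro integral_mono gstar_integral(1) wstar_ge \<omega> wg wstar_in_S) (use \<pi>S in \<open>auto simp: space_P\<close>)
  also have "\<dots> = (\<integral>z. coeff_vec \<zeta> (snd z) \<omega> \<bullet> wstar (gstar (fst z)) \<omega> \<partial>P)"
    by (rule gstar_integral(2)[OF wg]) (intro wstar_in_S \<omega>)
  finally show ?thesis using spo_risk_eq[OF \<omega>, of G] spo_risk_eq[OF \<omega>, of gstar] by simp
qed

end

text \<open>
  \<open>Q\<close> is the law of the past observations, which determine the prediction model \<open>G y\<close> and the dual
  variables \<open>(lam y, th y)\<close> of the round.
\<close>

locale decision_round = decision_problem P X S \<Lambda> \<Theta> \<zeta> wstar gstar K B + Q: prob_space Q
  for P :: "('p::finite, 'd::finite, 'm::finite) obs measure" and X S \<Lambda> \<Theta> \<zeta> wstar gstar K B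
    and Q :: "'q measure" +
  fixes G :: "'q \<Rightarrow> real ^ 'p \<Rightarrow> ('d, 'm) outcome" and lam th :: "'q \<Rightarrow> real ^ 'm"
  assumes G_measurable: "(\<lambda>(y, x). G y x) \<in> borel_measurable (Q \<Otimes>\<^sub>M context_space X)"
    and dual_measurable [measurable]: "lam \<in> borel_measurable Q" "th \<in> borel_measurable Q"
    and dual_in: "\<And>y. y \<in> space Q \<Longrightarrow> (lam y, th y) \<in> \<Lambda> \<times> \<Theta>"
begin

definition W :: "'q \<Rightarrow> real ^ 'p \<Rightarrow> real ^ 'd" where
  "W y x = wstar (G y x) (lam y, th y)"

definition dual :: "'q \<Rightarrow> real ^ 'm" where
  "dual y = lam y + \<zeta> *\<^sub>R th y"

definition excess :: "'q \<Rightarrow> real" where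
  "excess y = spo_risk P wstar \<zeta> (G y) (lam y, th y) - spo_risk P wstar \<zeta> gstar (lam y, th y)"

sublocale PQ: pair_prob_space P Q ..

lemma G_comp [measurable (raw)]:
  assumes "f \<in> M \<rightarrow>\<^sub>M Q" "g \<in> M \<rightarrow>\<^sub>M context_space X"
  shows "(\<lambda>x. G (f x) (g x)) \<in> borel_measurable M"
  using measurable_compose[OF measurable_Pair[OF assms] G_measurable] by simp

lemma G_in [measurable]: "y \<in> space Q \<Longrightarrow> G y \<in> borel_measurable (context_space X)"
  by (rule G_comp) auto

lemma dual_comp [measurable (raw)]:
  assumes "f \<in> M \<rightarrow>\<^sub>M Q"
  shows "(\<lambda>x. lam (f x)) \<in> borel_measurable M" "(\<lambda>x. th (f x)) \<in> borel_measurable M"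
  using measurable_compose[OF assms dual_measurable(1)] measurable_compose[OF assms dual_measurable(2)] by auto

lemma W_comp [measurable (raw)]:
  assumes [measurable]: "f \<in> M \<rightarrow>\<^sub>M Q" "g \<in> M \<rightarrow>\<^sub>M context_space X"
  shows "(\<lambda>x. W (f x) (g x)) \<in> borel_measurable M"
  unfolding W_def by measurable

lemma dual_meas [measurable]: "dual \<in> borel_measurable Q"
  unfolding dual_def by measurable

lemma W_in_S: "y \<in> space Q \<Longrightarrow> W y x \<in> S"
  unfolding W_def by (intro wstar_in_S dual_in)

lemma norm_W_le: "y \<in> space Q \<Longrightarrow> norm (W y x) \<le> K"
  by (intro S_le W_in_S)

lemma norm_dual_le: "y \<in> space Q \<Longrightarrow> norm (dual y) \<le> B"
  unfolding dual_def using dual_in[of y] by (intro dual_le) auto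

text \<open>The past enters the integrands through bounded quantities such as \<open>W\<close> and
  \<open>dual\<close>, so domination by the fresh observation alone suffices on the product
  space.\<close>

lemma integrable_pair_bound:
  fixes f :: "('p, 'd, 'm) obs \<times> 'q \<Rightarrow> 'e::{banach, second_countable_topology}"
  assumes [measurable]: "f \<in> borel_measurable (P \<Otimes>\<^sub>M Q)"
    and "\<And>z y. y \<in> space Q \<Longrightarrow> norm (f (z, y)) \<le> norm (fst (snd z)) * c + norm (snd (snd z)) * d"
  shows "integrable (P \<Otimes>\<^sub>M Q) f"
proof (rule Bochner_Integration.integrable_bound)
  show "integrable (P \<Otimes>\<^sub>M Q) (\<lambda>p. norm (fst (snd (fst p))) * c + norm (snd (snd (fst p))) * d)"
    by (rule integrable_pair_fst[OF Q.prob_space_axioms integrable_reward_bound])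
  show "AE p in P \<Otimes>\<^sub>M Q. norm (f p) \<le> norm (norm (fst (snd (fst p))) * c + norm (snd (snd (fst p))) * d)"
    using assms(2) by (intro AE_I2) (fastforce simp: space_pair_measure intro: order_trans[OF _ abs_ge_self])
qed fact

lemma integrable_W:
  "integrable (P \<Otimes>\<^sub>M Q) (\<lambda>(z, y). fst (snd z) \<bullet> W y (fst z))"
  "integrable (P \<Otimes>\<^sub>M Q) (\<lambda>(z, y). transpose (snd (snd z)) *v W y (fst z))"
  "integrable (P \<Otimes>\<^sub>M Q) (\<lambda>(z, y). fst (snd z) \<bullet> W y (fst z) + (c - transpose (snd (snd z)) *v W y (fst z)) \<bullet> dual y)"
proof -
  have V_le: "norm (transpose (snd (snd z)) *v W y (fst z)) \<le> norm (snd (snd z)) * K" if "y \<in> space Q" for z :: "('p, 'd, 'm) obs" and y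
    by (rule order_trans[OF norm_transpose_matrix_vector_mult_le]) (intro mult_left_mono norm_W_le that norm_ge_zero)
  have r_le: "\<bar>fst (snd z) \<bullet> W y (fst z)\<bar> \<le> norm (fst (snd z)) * K" if "y \<in> space Q" for z :: "('p, 'd, 'm) obs" and y
    by (rule order_trans[OF Cauchy_Schwarz_ineq2]) (intro mult_left_mono norm_W_le that norm_ge_zero)
  show "integrable (P \<Otimes>\<^sub>M Q) (\<lambda>(z, y). transpose (snd (snd z)) *v W y (fst z))"
    by (rule integrable_pair_bound[where c = 0 and d = K]) (measurable, use V_le in simp)
  show r: "integrable (P \<Otimes>\<^sub>M Q) (\<lambda>(z, y). fst (snd z) \<bullet> W y (fst z))"
    by (rule integrable_pair_bound[where c = K and d = 0]) (measurable, use r_le in simp)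
  have "integrable (P \<Otimes>\<^sub>M Q) (\<lambda>(z, y). (transpose (snd (snd z)) *v W y (fst z)) \<bullet> dual y)"
  proof (rule integrable_pair_bound[where c = 0 and d = "K * B"])
    fix z :: "('p, 'd, 'm) obs" and y assume y: "y \<in> space Q"
    have "\<bar>(transpose (snd (snd z)) *v W y (fst z)) \<bullet> dual y\<bar> \<le> (norm (snd (snd z)) * K) * B"
      by (rule order_trans[OF Cauchy_Schwarz_ineq2])
        (intro mult_mono V_le[OF y] norm_dual_le[OF y] mult_nonneg_nonneg norm_ge_zero K_nonneg)
    then show "norm ((\<lambda>(z, y). (transpose (snd (snd z)) *v W y (fst z)) \<bullet> dual y) (z, y))
        \<le> norm (fst (snd z)) * 0 + norm (snd (snd z)) * (K * B)" by (simp add: mult_ac)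
  qed measurable
  moreover have "integrable (P \<Otimes>\<^sub>M Q) (\<lambda>(z, y). c \<bullet> dual y)"
  proof (rule PQ.integrable_const_bound[where B = "norm c * B"])
    show "AE p in P \<Otimes>\<^sub>M Q. norm (case p of (z, y) \<Rightarrow> c \<bullet> dual y) \<le> norm c * B"
      by (intro AE_I2) (auto simp: space_pair_measure intro!: order_trans[OF Cauchy_Schwarz_ineq2] mult_left_mono norm_dual_le)
  qed measurable
  ultimately show "integrable (P \<Otimes>\<^sub>M Q)
      (\<lambda>(z, y). fst (snd z) \<bullet> W y (fst z) + (c - transpose (snd (snd z)) *v W y (fst z)) \<bullet> dual y)"
    using r by (simp add: case_prod_beta' inner_diff_left del: transpose_matrix_vector)
qed

text \<open>The excess is a difference of Lagrangian rewards of two decisions in \<open>S\<close>,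
  each bounded uniformly in the past by \<open>?C\<close>. Measurability rests on the model being
  jointly measurable in past and context.\<close>

lemma integrable_excess: "integrable Q excess"
proof (rule Q.integrable_const_bound)
  let ?C = "\<integral>z. norm (fst (snd z)) * K + norm (snd (snd z)) * (B * K) \<partial>P"
  have le: "\<bar>\<integral>z. coeff_vec \<zeta> (snd z) (lam y, th y) \<bullet> f z \<partial>P\<bar> \<le> ?C"
    if y: "y \<in> space Q" and f: "\<And>z. z \<in> space P \<Longrightarrow> f z \<in> S" "f \<in> borel_measurable P" for y f
    by (rule order_trans[OF integral_abs_bound])
      (intro integral_mono integrable_abs integrable_coeff_vec integrable_reward_bound inner_coeff_vec_le
        dual_in y f S_le)
  show "AE y in Q. norm (excess y) \<le> ?C + ?C"
  proof (rule AE_I2)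
    fix y assume y: "y \<in> space Q"
    note [measurable] = G_in[OF y]
    have "excess y = (\<integral>z. coeff_vec \<zeta> (snd z) (lam y, th y) \<bullet> wstar (gstar (fst z)) (lam y, th y) \<partial>P)
      - (\<integral>z. coeff_vec \<zeta> (snd z) (lam y, th y) \<bullet> wstar (G y (fst z)) (lam y, th y) \<partial>P)"
      unfolding excess_def using spo_risk_eq[OF dual_in[OF y], of gstar] spo_risk_eq[OF dual_in[OF y], of "G y"] by simp
    moreover note le[OF y, of "\<lambda>z. wstar (gstar (fst z)) (lam y, th y)"]
      le[OF y, of "\<lambda>z. wstar (G y (fst z)) (lam y, th y)"]
    ultimately show "norm (excess y) \<le> ?C + ?C"
      using wstar_in_S[OF dual_in[OF y]] by (simp add: abs_le_iff)
  qed
  show "excess \<in> borel_measurable Q"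
    unfolding excess_def spo_risk_def spo_loss_def case_prod_beta' by measurable
qed

text \<open>\<open>F\<close> stands for a supremum over all dual pairs, possibly not measurable, so
  only monotonicity of the nonnegative integral is applied to it. Truncating \<open>excess\<close>
  at 0 by \<open>ennreal\<close> can only increase its integral.\<close>

lemma integral_excess_le:
  assumes "(\<integral>\<^sup>+y. F y \<partial>Q) \<le> ennreal e" "e \<ge> 0" "\<And>y. y \<in> space Q \<Longrightarrow> ennreal (excess y) \<le> F y"
  shows "(\<integral>y. excess y \<partial>Q) \<le> e"
proof -
  have "(\<integral>y. excess y \<partial>Q) \<le> enn2real (\<integral>\<^sup>+y. ennreal (excess y) \<partial>Q)"
    unfolding real_lebesgue_integral_def[OF integrable_excess] by simp
  also have "\<dots> \<le> enn2real (ennreal e)"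
    by (intro enn2real_mono order_trans[OF nn_integral_mono assms(1)] assms(3)) auto
  finally show ?thesis using assms(2) by simp
qed

text \<open>\<open>policy_le_decision\<close> is applied for each fixed past and integrated by
  Fubini. Moving the term with \<open>con P \<pi>\<close> to the right makes the dual variables
  multiply the gap between the consumption of the policy and the incurred one, which is the quantity
  that the regret bounds control.\<close>

lemma policy_le_round:
  assumes "\<pi> \<in> policies X S"
  shows "rew P \<pi> - (\<integral>y. excess y \<partial>Q) \<le> (\<integral>(z, y). fst (snd z) \<bullet> W y (fst z)
      + (con P \<pi> - transpose (snd (snd z)) *v W y (fst z)) \<bullet> dual y \<partial>(P \<Otimes>\<^sub>M Q))"
proof -
  let ?f = "\<lambda>z y. fst (snd z) \<bullet> W y (fst z) + (con P \<pi> - transpose (snd (snd z)) *v W y (fst z)) \<bullet> dual y"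
  have int: "integrable (P \<Otimes>\<^sub>M Q) (case_prod ?f)" by (rule integrable_W)
  have "rew P \<pi> - (\<integral>y. excess y \<partial>Q) = (\<integral>y. rew P \<pi> - excess y \<partial>Q)"
    using integrable_excess by (simp add: Q.prob_space)
  also have "\<dots> \<le> (\<integral>y. (\<integral>z. ?f z y \<partial>P) \<partial>Q)"
  proof (rule integral_mono)
    show "integrable Q (\<lambda>y. rew P \<pi> - excess y)" using integrable_excess by simp
    show "integrable Q (\<lambda>y. \<integral>z. ?f z y \<partial>P)" by (rule PQ.integrable_snd[OF int])
    fix y assume y: "y \<in> space Q"
    note [measurable] = G_in[OF y]
    have "integrable P (\<lambda>z. coeff_vec \<zeta> (snd z) (lam y, th y) \<bullet> wstar (G y (fst z)) (lam y, th y))"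
      by (intro integrable_coeff_vec dual_in y wstar_in_S) measurable
    moreover have "(\<lambda>z. ?f z y) = (\<lambda>z. coeff_vec \<zeta> (snd z) (lam y, th y) \<bullet> wstar (G y (fst z)) (lam y, th y)
        + con P \<pi> \<bullet> dual y)"
      by (intro ext) (simp add: inner_coeff_vec W_def dual_def inner_diff_left del: transpose_matrix_vector)
    ultimately have "(\<integral>z. ?f z y \<partial>P) = (\<integral>z. coeff_vec \<zeta> (snd z) (lam y, th y) \<bullet> wstar (G y (fst z)) (lam y, th y) \<partial>P)
        + con P \<pi> \<bullet> dual y"
      by (simp add: prob_space)
    then show "rew P \<pi> - excess y \<le> (\<integral>z. ?f z y \<partial>P)"
      using policy_le_decision[OF dual_in[OF y] G_in[OF y] assms] by (simp add: excess_def dual_def)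
  qed
  also have "\<dots> = (\<integral>(z, y). ?f z y \<partial>(P \<Otimes>\<^sub>M Q))" by (rule PQ.integral_snd[OF int])
  finally show ?thesis .
qed

definition mean_policy :: "real ^ 'p \<Rightarrow> real ^ 'd" where
  "mean_policy x = (\<integral>y. W y x \<partial>Q)"

text \<open>Reward and consumption are linear in the decision, and the fresh observation is
  independent of the past, so Fubini moves the average over the past into the decision.\<close>

lemma mean_policy:
  "mean_policy \<in> policies X S"
  "rew P mean_policy = (\<integral>(z, y). fst (snd z) \<bullet> W y (fst z) \<partial>(P \<Otimes>\<^sub>M Q))"
  "con P mean_policy = (\<integral>(z, y). transpose (snd (snd z)) *v W y (fst z) \<partial>(P \<Otimes>\<^sub>M Q))"
proof -
  have int: "integrable Q (\<lambda>y. W y x)" if "x \<in> X" for x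
  proof (rule Q.integrable_const_bound[where B = K])
    have "x \<in> space (context_space X)" using that by (simp add: space_restrict_space)
    then show "(\<lambda>y. W y x) \<in> borel_measurable Q" by measurable
  qed (auto intro: norm_W_le)
  show \<pi>: "mean_policy \<in> policies X S"
    unfolding policies_def
  proof (intro CollectI conjI ballI)
    show "mean_policy \<in> borel_measurable (context_space X)" unfolding mean_policy_def by measurable
    show "mean_policy x \<in> S" if "x \<in> X" for x
      unfolding mean_policy_def
      by (rule Q.integral_in_closed_convex[OF convex_S closed_S int[OF that]]) (rule W_in_S)
  qed
  have "rew P mean_policy = (\<integral>z. (\<integral>y. fst (snd z) \<bullet> W y (fst z) \<partial>Q) \<partial>P)"
    unfolding policy_integrals(3)[OF \<pi>] mean_policy_def
    by (intro Bochner_Integration.integral_cong refl integral_inner_right[symmetric])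
      (use int in \<open>auto simp: space_P\<close>)
  also have "\<dots> = (\<integral>(z, y). fst (snd z) \<bullet> W y (fst z) \<partial>(P \<Otimes>\<^sub>M Q))"
    by (rule PQ.integral_fst[OF integrable_W(1)])
  finally show "rew P mean_policy = (\<integral>(z, y). fst (snd z) \<bullet> W y (fst z) \<partial>(P \<Otimes>\<^sub>M Q))" .
  have "con P mean_policy = (\<integral>z. (\<integral>y. transpose (snd (snd z)) *v W y (fst z) \<partial>Q) \<partial>P)"
    unfolding policy_integrals(4)[OF \<pi>] mean_policy_def
    by (intro Bochner_Integration.integral_cong refl integral_bounded_linear[symmetric]
        bounded_bilinear.bounded_linear_right[OF bounded_bilinear_transpose_matrix_vector_mult])
      (use int in \<open>auto simp: space_P\<close>)
  also have "\<dots> = (\<integral>(z, y). transpose (snd (snd z)) *v W y (fst z) \<partial>(P \<Otimes>\<^sub>M Q))"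
    by (rule PQ.integral_fst[OF integrable_W(2)])
  finally show "con P mean_policy = (\<integral>(z, y). transpose (snd (snd z)) *v W y (fst z) \<partial>(P \<Otimes>\<^sub>M Q))" .
qed

end

lemma policies_mean:
  assumes "convex S" "T > 0" "\<And>t. t \<in> {1..T} \<Longrightarrow> \<pi> t \<in> policies X S"
  shows "(\<lambda>x. (1 / real T) *\<^sub>R (\<Sum>t=1..T. \<pi> t x)) \<in> policies X S"
  unfolding policies_def
proof (intro CollectI conjI ballI)
  have "\<pi> t \<in> borel_measurable (context_space X)" if "t \<in> {1..T}" for t
    using assms(3)[OF that] by (simp add: policies_def)
  then show "(\<lambda>x. (1 / real T) *\<^sub>R (\<Sum>t=1..T. \<pi> t x)) \<in> borel_measurable (context_space X)"
    by (intro borel_measurable_scaleR borel_measurable_const borel_measurable_sum)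
  fix x assume "x \<in> X"
  have "(\<Sum>t=1..T. (1 / real T) *\<^sub>R \<pi> t x) \<in> S"
  proof (rule convex_sum[OF _ assms(1)])
    show "(\<Sum>t=1..T. 1 / real T) = 1" using assms(2) by simp
    show "\<pi> t x \<in> S" if "t \<in> {1..T}" for t
      using assms(3)[OF that] \<open>x \<in> X\<close> by (simp add: policies_def)
  qed auto
  then show "(1 / real T) *\<^sub>R (\<Sum>t=1..T. \<pi> t x) \<in> S" by (simp add: scaleR_sum_right)
qed

lemma (in decision_problem) rew_con_mean:
  assumes "T > 0" and \<pi>: "\<And>t. t \<in> {1..T} \<Longrightarrow> \<pi> t \<in> policies X S"
  shows "rew P (\<lambda>x. (1 / real T) *\<^sub>R (\<Sum>t=1..T. \<pi> t x)) = (1 / real T) * (\<Sum>t=1..T. rew P (\<pi> t))"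
    "con P (\<lambda>x. (1 / real T) *\<^sub>R (\<Sum>t=1..T. \<pi> t x)) = (1 / real T) *\<^sub>R (\<Sum>t=1..T. con P (\<pi> t))"
proof -
  let ?\<pi> = "\<lambda>x. (1 / real T) *\<^sub>R (\<Sum>t=1..T. \<pi> t x)"
  have mean: "?\<pi> \<in> policies X S" by (rule policies_mean[OF convex_S assms])
  have "rew P ?\<pi> = (\<integral>z. (1 / real T) * (\<Sum>t=1..T. fst (snd z) \<bullet> \<pi> t (fst z)) \<partial>P)"
    unfolding policy_integrals(3)[OF mean] by (simp add: inner_sum_right)
  also have "\<dots> = (1 / real T) * (\<Sum>t=1..T. \<integral>z. fst (snd z) \<bullet> \<pi> t (fst z) \<partial>P)"
    by (subst integral_mult_right_zero, subst Bochner_Integration.integral_sum) (use policy_integrals(1)[OF \<pi>] in auto)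
  finally show "rew P ?\<pi> = (1 / real T) * (\<Sum>t=1..T. rew P (\<pi> t))"
    using policy_integrals(3)[OF \<pi>] by simp
  interpret tm: bounded_bilinear "\<lambda>(A :: real ^ 'm ^ 'd) a. transpose A *v a"
    by (rule bounded_bilinear_transpose_matrix_vector_mult)
  have "con P ?\<pi> = (\<integral>z. (1 / real T) *\<^sub>R (\<Sum>t=1..T. transpose (snd (snd z)) *v \<pi> t (fst z)) \<partial>P)"
    unfolding policy_integrals(4)[OF mean] by (simp add: tm.scaleR_right tm.sum_right del: transpose_matrix_vector)
  also have "\<dots> = (1 / real T) *\<^sub>R (\<Sum>t=1..T. \<integral>z. transpose (snd (snd z)) *v \<pi> t (fst z) \<partial>P)"
    by (subst integral_scaleR_right, subst Bochner_Integration.integral_sum)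
      (use policy_integrals(2)[OF \<pi>] in \<open>auto simp del: transpose_matrix_vector\<close>)
  finally show "con P ?\<pi> = (1 / real T) *\<^sub>R (\<Sum>t=1..T. con P (\<pi> t))"
    using policy_integrals(4)[OF \<pi>] by (simp del: transpose_matrix_vector)
qed

section \<open>All rounds\<close>

text \<open>Adaptedness is invariance under restriction to the first t - 1 observations: a function
  of the whole sequence then doubles as a function of the past with law
  \<open>iid P (t - 1)\<close>. In round 1 this law lives on a single empty sequence.\<close>

locale online_run = decision_problem P X S \<Lambda> \<Theta> \<zeta> wstar gstar K B
  for P :: "('p::finite, 'd::finite, 'm::finite) obs measure" and X S \<Lambda> \<Theta> \<zeta> wstar gstar K B +
  fixes T :: nat and lam th :: "(nat \<Rightarrow> ('p, 'd, 'm) obs) \<Rightarrow> nat \<Rightarrow> real ^ 'm"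
    and g :: "(nat \<Rightarrow> ('p, 'd, 'm) obs) \<Rightarrow> nat \<Rightarrow> real ^ 'p \<Rightarrow> ('d, 'm) outcome"
    and w :: "(nat \<Rightarrow> ('p, 'd, 'm) obs) \<Rightarrow> nat \<Rightarrow> real ^ 'd"
  assumes T: "T > 0"
    and round: "\<And>t. t \<in> {1..T} \<Longrightarrow> decision_round P X S \<Lambda> \<Theta> \<zeta> wstar gstar K B (iid P (t - 1))
          (\<lambda>y. g y t) (\<lambda>y. lam y t) (\<lambda>y. th y t)"
    and past: "\<And>z t. t \<in> {1..T} \<Longrightarrow> lam z t = lam (restrict z {1..t - 1}) t"
      "\<And>z t. t \<in> {1..T} \<Longrightarrow> th z t = th (restrict z {1..t - 1}) t"
      "\<And>z t. t \<in> {1..T} \<Longrightarrow> g z t = g (restrict z {1..t - 1}) t"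
    and w: "\<And>z t. t \<in> {1..T} \<Longrightarrow> w z t = wstar (g z t (fst (z t))) (lam z t, th z t)"
begin

definition mean_excess :: "nat \<Rightarrow> real" where
  "mean_excess t = (\<integral>y. spo_risk P wstar \<zeta> (g y t) (lam y t, th y t)
     - spo_risk P wstar \<zeta> gstar (lam y t, th y t) \<partial>iid P (t - 1))"

sublocale iid: prob_space "iid P T"
  by (rule PiM_prob_space)

lemma round_integral:
  fixes f :: "_ \<Rightarrow> 'b::{banach, second_countable_topology}"
  assumes "t \<in> {1..T}" "integrable (P \<Otimes>\<^sub>M iid P (t - 1)) f"
  shows "integrable (iid P T) (\<lambda>z. f (z t, restrict z {1..t - 1}))"
    "(\<integral>z. f (z t, restrict z {1..t - 1}) \<partial>iid P T) = (\<integral>p. f p \<partial>(P \<Otimes>\<^sub>M iid P (t - 1)))"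
proof -
  have "t - 1 < T" "Suc (t - 1) = t" using assms(1) by auto
  with PiM_last_integral[of "t - 1" T f] assms(2)
  show "integrable (iid P T) (\<lambda>z. f (z t, restrict z {1..t - 1}))"
    "(\<integral>z. f (z t, restrict z {1..t - 1}) \<partial>iid P T) = (\<integral>p. f p \<partial>(P \<Otimes>\<^sub>M iid P (t - 1)))"
    by metis+
qed

text \<open>All claims come from writing decision and dual vector of round t as functions of
  \<open>restrict z {1..t - 1}\<close> and \<open>z t\<close>, whose joint law is a product; the
  single-round results then transfer to the full horizon.\<close>

lemma round_facts:
  assumes t: "t \<in> {1..T}"
  shows "integrable (iid P T) (\<lambda>z. fst (snd (z t)) \<bullet> w z t)"
    "integrable (iid P T) (\<lambda>z. consumption z (w z) t)"
    "integrable (iid P T) (\<lambda>z. fst (snd (z t)) \<bullet> w z t + (c - consumption z (w z) t) \<bullet> (lam z t + \<zeta> *\<^sub>R th z t))"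
    "\<pi> \<in> policies X S \<Longrightarrow> rew P \<pi> - mean_excess t \<le> (\<integral>z. fst (snd (z t)) \<bullet> w z t
        + (con P \<pi> - consumption z (w z) t) \<bullet> (lam z t + \<zeta> *\<^sub>R th z t) \<partial>iid P T)"
    "\<exists>\<pi>\<in>policies X S. rew P \<pi> = (\<integral>z. fst (snd (z t)) \<bullet> w z t \<partial>iid P T)
        \<and> con P \<pi> = (\<integral>z. consumption z (w z) t \<partial>iid P T)"
proof -
  interpret R: decision_round P X S \<Lambda> \<Theta> \<zeta> wstar gstar K B "iid P (t - 1)"
    "\<lambda>y. g y t" "\<lambda>y. lam y t" "\<lambda>y. th y t" by (rule round[OF t])
  have wt: "w z t = R.W (restrict z {1..t - 1}) (fst (z t))" for z
    unfolding R.W_def w[OF t] by (simp only: past[OF t, of z])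
  have dt: "lam z t + \<zeta> *\<^sub>R th z t = R.dual (restrict z {1..t - 1})" for z
    unfolding R.dual_def by (simp only: past[OF t, of z])
  note I = R.integrable_W[THEN round_integral(1)[OF t], unfolded prod.case]
  note E = R.integrable_W[THEN round_integral(2)[OF t], unfolded prod.case]
  show "integrable (iid P T) (\<lambda>z. fst (snd (z t)) \<bullet> w z t)"
    unfolding wt by (rule I(1))
  show "integrable (iid P T) (\<lambda>z. consumption z (w z) t)"
    unfolding wt consumption_def by (rule I(2))
  show "integrable (iid P T) (\<lambda>z. fst (snd (z t)) \<bullet> w z t + (c - consumption z (w z) t) \<bullet> (lam z t + \<zeta> *\<^sub>R th z t))"
    unfolding wt dt consumption_def by (rule I(3))
  have ex: "mean_excess t = (\<integral>y. R.excess y \<partial>iid P (t - 1))"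
    unfolding mean_excess_def R.excess_def ..
  show "rew P \<pi> - mean_excess t \<le> (\<integral>z. fst (snd (z t)) \<bullet> w z t
        + (con P \<pi> - consumption z (w z) t) \<bullet> (lam z t + \<zeta> *\<^sub>R th z t) \<partial>iid P T)" if "\<pi> \<in> policies X S"
    unfolding wt dt consumption_def E(3) ex by (rule R.policy_le_round[OF that])
  show "\<exists>\<pi>\<in>policies X S. rew P \<pi> = (\<integral>z. fst (snd (z t)) \<bullet> w z t \<partial>iid P T)
        \<and> con P \<pi> = (\<integral>z. consumption z (w z) t \<partial>iid P T)"
    unfolding wt consumption_def E(1,2) by (intro bexI[of _ R.mean_policy] conjI R.mean_policy)
qed

lemma integrable_avg:
  "integrable (iid P T) (\<lambda>z. avg_reward T z (w z))"
  "integrable (iid P T) (\<lambda>z. avg_consumption T z (w z))"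
  unfolding avg_reward_def avg_consumption_def
  by (intro integrable_mult_right integrable_scaleR_right Bochner_Integration.integrable_sum round_facts; assumption)+

text \<open>
  Averaging the decisions over the rounds and over the independent past turns the algorithm into
  a policy with the same expected reward and consumption.
\<close>

lemma averaged_policy:
  obtains \<pi> where "\<pi> \<in> policies X S" "rew P \<pi> = (\<integral>z. avg_reward T z (w z) \<partial>iid P T)"
    "con P \<pi> = (\<integral>z. avg_consumption T z (w z) \<partial>iid P T)"
proof -
  have "\<forall>t\<in>{1..T}. \<exists>\<pi>. \<pi> \<in> policies X S \<and> rew P \<pi> = (\<integral>z. fst (snd (z t)) \<bullet> w z t \<partial>iid P T)
      \<and> con P \<pi> = (\<integral>z. consumption z (w z) t \<partial>iid P T)"
    using round_facts(5) by blast
  from bchoice[OF this] obtain \<pi> where \<pi>: "\<And>t. t \<in> {1..T} \<Longrightarrow> \<pi> t \<in> policies X S"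
    "\<And>t. t \<in> {1..T} \<Longrightarrow> rew P (\<pi> t) = (\<integral>z. fst (snd (z t)) \<bullet> w z t \<partial>iid P T)"
    "\<And>t. t \<in> {1..T} \<Longrightarrow> con P (\<pi> t) = (\<integral>z. consumption z (w z) t \<partial>iid P T)" by blast
  let ?\<pi> = "\<lambda>x. (1 / real T) *\<^sub>R (\<Sum>t=1..T. \<pi> t x)"
  have mean: "rew P ?\<pi> = (1 / real T) * (\<Sum>t=1..T. rew P (\<pi> t))"
    "con P ?\<pi> = (1 / real T) *\<^sub>R (\<Sum>t=1..T. con P (\<pi> t))"
    by (rule rew_con_mean[OF T], erule \<pi>(1))+
  show ?thesis
  proof
    show "?\<pi> \<in> policies X S" by (rule policies_mean[OF convex_S T \<pi>(1)])
    show "rew P ?\<pi> = (\<integral>z. avg_reward T z (w z) \<partial>iid P T)"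
      unfolding mean(1) avg_reward_def
      by (subst integral_mult_right_zero, subst Bochner_Integration.integral_sum)
        (rule round_facts(1), assumption, simp add: \<pi>(2) cong: sum.cong_simp)
    show "con P ?\<pi> = (\<integral>z. avg_consumption T z (w z) \<partial>iid P T)"
      unfolding mean(2) avg_consumption_def
      by (subst integral_scaleR_right, subst Bochner_Integration.integral_sum)
        (rule round_facts(2), assumption, simp add: \<pi>(3) cong: sum.cong_simp)
  qed
qed

text \<open>The regret bounds hold almost surely for each fixed \<open>c\<close>, and the
  deterministic point \<open>con P \<pi>\<close> is an admissible choice. There the distance
  vanishes by feasibility, while \<open>u\<close> supplies the missing part of the benchmark
  objective.\<close>

lemma benchmark_le:
  fixes N u :: "real ^ 'm \<Rightarrow> real" and R1 R2 L :: real
  assumes \<pi>: "\<pi> \<in> policies X S" "con P \<pi> \<in> \<V>"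
    and N: "is_norm N" and u: "\<And>a b. \<bar>u a - u b\<bar> \<le> L * N (a - b)" and \<V>: "\<V> \<noteq> {}" and "\<zeta> > 0"
    and regret_lam: "\<And>c. AE z in iid P T. (\<Sum>t=1..T. (c - consumption z (w z) t) \<bullet> lam z t)
        \<le> T * u (avg_consumption T z (w z)) - T * u c + R1"
    and regret_th: "\<And>c. AE z in iid P T. (\<Sum>t=1..T. (c - consumption z (w z) t) \<bullet> th z t)
        \<le> T * dist_to N \<V> c - T * dist_to N \<V> (avg_consumption T z (w z)) + R2"
  shows "rew P \<pi> + u (con P \<pi>) \<le> (\<integral>z. avg_reward T z (w z) + u (avg_consumption T z (w z)) \<partial>iid P T)
    - \<zeta> * (\<integral>z. dist_to N \<V> (avg_consumption T z (w z)) \<partial>iid P T)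
    + (R1 + \<zeta> * R2) / T + (\<Sum>t=1..T. mean_excess t) / T"
proof -
  let ?c = "con P \<pi>" and ?v = "\<lambda>z. avg_consumption T z (w z)" and ?d = "dist_to N \<V>"
  note int_u = iid.lipschitz_integrable[OF N u integrable_avg(2)]
  note int_d = iid.lipschitz_integrable[OF N dist_to_lipschitz[OF N \<V>] integrable_avg(2)]
  note int = integrable_avg(1) int_u int_d
  let ?f = "\<lambda>z t. fst (snd (z t)) \<bullet> w z t + (?c - consumption z (w z) t) \<bullet> (lam z t + \<zeta> *\<^sub>R th z t)"
  have "T * rew P \<pi> - (\<Sum>t=1..T. mean_excess t) = (\<Sum>t=1..T. rew P \<pi> - mean_excess t)"
    by (simp add: sum_subtractf)
  also have "\<dots> \<le> (\<Sum>t=1..T. \<integral>z. ?f z t \<partial>iid P T)"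
    by (intro sum_mono round_facts(4) \<pi>)
  also have "\<dots> = (\<integral>z. (\<Sum>t=1..T. ?f z t) \<partial>iid P T)"
    by (rule Bochner_Integration.integral_sum[symmetric]) (rule round_facts(3))
  also have "\<dots> \<le> (\<integral>z. T * (avg_reward T z (w z) + u (?v z)) - T * (\<zeta> * ?d (?v z)) + (R1 + \<zeta> * R2 - T * u ?c) \<partial>iid P T)"
  proof (rule integral_mono_AE)
    show "integrable (iid P T) (\<lambda>z. \<Sum>t=1..T. ?f z t)"
      by (rule Bochner_Integration.integrable_sum) (rule round_facts(3))
    show "integrable (iid P T) (\<lambda>z. T * (avg_reward T z (w z) + u (?v z)) - T * (\<zeta> * ?d (?v z)) + (R1 + \<zeta> * R2 - T * u ?c))"
      by (intro Bochner_Integration.integrable_add Bochner_Integration.integrable_diff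
          integrable_mult_right int iid.integrable_const)
    show "AE z in iid P T. (\<Sum>t=1..T. ?f z t)
        \<le> T * (avg_reward T z (w z) + u (?v z)) - T * (\<zeta> * ?d (?v z)) + (R1 + \<zeta> * R2 - T * u ?c)"
      using regret_lam[of ?c] regret_th[of ?c]
    proof eventually_elim
      case (elim z)
      let ?A = "\<Sum>t=1..T. (?c - consumption z (w z) t) \<bullet> lam z t"
      let ?B = "\<Sum>t=1..T. (?c - consumption z (w z) t) \<bullet> th z t"
      have "(\<Sum>t=1..T. ?f z t) = T * avg_reward T z (w z) + ?A + \<zeta> * ?B"
        using T by (simp add: avg_reward_def inner_add_right sum.distrib sum_distrib_left)
      moreover have "\<zeta> * ?B \<le> \<zeta> * (R2 - T * ?d (?v z))"
        using elim(2) \<open>\<zeta> > 0\<close> dist_to_eq_0[OF N \<pi>(2)] by (intro mult_left_mono) auto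
      ultimately show ?case using elim(1) by (simp add: algebra_simps)
    qed
  qed
  also have "\<dots> = T * (\<integral>z. avg_reward T z (w z) + u (?v z) \<partial>iid P T) - T * (\<zeta> * (\<integral>z. ?d (?v z) \<partial>iid P T))
      + (R1 + \<zeta> * R2 - T * u ?c)"
    by (rule iid.integral_affine) (intro Bochner_Integration.integrable_add int)+
  finally show ?thesis using T by (simp add: field_simps)
qed

end

section \<open>The performance guarantee\<close>

text \<open>All processes are indexed by the horizon because the step sizes depend on it. The factor
  10 is a common round value: for large horizons the errors amount to at most 5 / 2 of the mirror
  descent term and 2 of the risk term, and division by the penalty margin leaves at most 5 and
  2.\<close>

theorem theorem2:
  fixes X :: "(real ^ 'p) set" and S :: "(real ^ 'd) set" and \<V> :: "(real ^ 'm) set"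
    and u :: "real ^ 'm \<Rightarrow> real" and L :: real and N :: "real ^ 'm \<Rightarrow> real"
    and P :: "('p, 'd, 'm) obs measure"
    and \<Lambda> \<Theta> :: "(real ^ 'm) set" and \<zeta> :: real
    and wstar :: "('d, 'm) outcome \<Rightarrow> (real ^ 'm) \<times> (real ^ 'm) \<Rightarrow> real ^ 'd"
    and l :: "real ^ 'd \<Rightarrow> real ^ 'd \<Rightarrow> real"
    and H :: "(real ^ 'p \<Rightarrow> ('d, 'm) outcome) set"
    and gstar g1 :: "real ^ 'p \<Rightarrow> ('d, 'm) outcome"
    and erm :: "nat \<Rightarrow> (nat \<Rightarrow> ('p, 'd, 'm) obs) \<Rightarrow> (real ^ 'm) \<times> (real ^ 'm) \<Rightarrow>
                  real ^ 'p \<Rightarrow> ('d, 'm) outcome"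
    and h_Lam h_Th :: "real ^ 'm \<Rightarrow> real" and gh_Lam gh_Th :: "real ^ 'm \<Rightarrow> real ^ 'm"
    and D_Lam D_Th G_Lam G_Th D_v \<kappa>_risk \<alpha> \<kappa>_MD \<zeta>_OPT \<rho> :: real
    and lam1 th1 :: "real ^ 'm"
    and lam th p q :: "nat \<Rightarrow> (nat \<Rightarrow> ('p, 'd, 'm) obs) \<Rightarrow> nat \<Rightarrow> real ^ 'm"
    and g :: "nat \<Rightarrow> (nat \<Rightarrow> ('p, 'd, 'm) obs) \<Rightarrow> nat \<Rightarrow> real ^ 'p \<Rightarrow> ('d, 'm) outcome"
    and w :: "nat \<Rightarrow> (nat \<Rightarrow> ('p, 'd, 'm) obs) \<Rightarrow> nat \<Rightarrow> real ^ 'd"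
  (* problem data *)
  assumes S: "convex S" "compact S"
    and \<V>: "closed \<V>" "convex \<V>" "\<V> \<noteq> {}"
    and N: "is_norm N"
    and u: "concave_on UNIV u" "\<And>a b. \<bar>u a - u b\<bar> \<le> L * N (a - b)" "u 0 = 0"
    and P: "prob_space P" "sets P = sets (context_space X \<Otimes>\<^sub>M borel)"
    and integrable: "integrable P (\<lambda>(x, r, V). r)" "integrable P (\<lambda>(x, r, V). V)"
  (* dual domains and mirror maps *)
    and \<Lambda>: "\<Lambda> = conj_domain (\<lambda>v. - u v)"
    and \<Theta>: "\<Theta> = conj_domain (dist_to N \<V>)"
    and \<zeta>: "\<zeta> > 0"
    and h_Lam: "is_gradient_on \<Lambda> h_Lam gh_Lam" "strongly_convex1_on \<Lambda> (dual_norm N) h_Lam"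
    and h_Th: "is_gradient_on \<Theta> h_Th gh_Th" "strongly_convex1_on \<Theta> (dual_norm N) h_Th"
    and D_Lam: "D_Lam > 0" "\<And>a b. a \<in> \<Lambda> \<Longrightarrow> b \<in> \<Lambda> \<Longrightarrow> bregman h_Lam gh_Lam a b \<le> D_Lam"
    and D_Th: "D_Th > 0" "\<And>a b. a \<in> \<Theta> \<Longrightarrow> b \<in> \<Theta> \<Longrightarrow> bregman h_Th gh_Th a b \<le> D_Th"
  (* linear optimization oracle, conditional mean, empirical risk minimizers *)
    and wstar: "\<And>\<mu> \<omega>. \<omega> \<in> \<Lambda> \<times> \<Theta> \<Longrightarrow>
          is_arg_max (\<lambda>a. coeff_vec \<zeta> \<mu> \<omega> \<bullet> a) (\<lambda>a. a \<in> S) (wstar \<mu> \<omega>)"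
        "(\<lambda>(\<mu>, \<omega>). wstar \<mu> \<omega>) \<in> borel_measurable borel"
    and gstar: "is_cond_mean X P gstar"
    and erm: "\<And>n z \<omega>. n > 0 \<Longrightarrow> z \<in> space (iid P n) \<Longrightarrow> \<omega> \<in> \<Lambda> \<times> \<Theta> \<Longrightarrow>
          is_arg_min (empirical_loss l \<zeta> n z \<omega>) (\<lambda>g. g \<in> H) (erm n z \<omega>)"
        "\<And>n. n > 0 \<Longrightarrow> (\<lambda>((z, \<omega>), x). erm n z \<omega> x)
          \<in> borel_measurable ((iid P n \<Otimes>\<^sub>M borel) \<Otimes>\<^sub>M context_space X)"
  (* the algorithm with horizon T on the data sequence z *)
    and init: "lam1 \<in> \<Lambda>" "th1 \<in> \<Theta>" "g1 \<in> borel_measurable (context_space X)"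
        "\<And>T z. lam T z 1 = lam1" "\<And>T z. th T z 1 = th1"
    and g: "\<And>T z t. g T z t =
          (if t = 1 then g1 else erm (t - 1) (restrict z {1..t - 1}) (lam T z t, th T z t))"
    and w: "\<And>T z t. w T z t = wstar (g T z t (fst (z t))) (lam T z t, th T z t)"
    and md_Lam: "\<And>T z. T > 0 \<Longrightarrow> z \<in> space (iid P T) \<Longrightarrow>
          mirror_descent \<Lambda> (\<lambda>v. - u v) h_Lam gh_Lam (sqrt D_Lam / (G_Lam * sqrt (real T))) T
            (consumption z (w T z)) (lam T z) (p T z)"
    and md_Th: "\<And>T z. T > 0 \<Longrightarrow> z \<in> space (iid P T) \<Longrightarrow>
          mirror_descent \<Theta> (dist_to N \<V>) h_Th gh_Th (sqrt D_Th / (G_Th * sqrt (real T))) T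
            (consumption z (w T z)) (th T z) (q T z)"
    and adapted: "\<And>T t. t \<in> {1..T} \<Longrightarrow> known_after P (t - 1) (\<lambda>z. lam T z t)"
        "\<And>T t. t \<in> {1..T} \<Longrightarrow> known_after P (t - 1) (\<lambda>z. th T z t)"
    and G_Lam: "G_Lam > 0" "\<And>T. T > 0 \<Longrightarrow> AE z in iid P T. \<forall>t\<in>{1..T}. N (p T z t) \<le> G_Lam"
    and G_Th: "G_Th > 0" "\<And>T. T > 0 \<Longrightarrow> AE z in iid P T. \<forall>t\<in>{1..T}. N (q T z t) \<le> G_Th"
  (* the ennreal truncation is vacuous: gstar minimizes the SPO risk, so the differences are >= 0 *)
    and cond1: "\<kappa>_risk > 0" "\<alpha> > 0"
        "\<And>n. n > 0 \<Longrightarrow>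
          (\<integral>\<^sup>+z. (SUP \<omega>\<in>\<Lambda> \<times> \<Theta>.
              ennreal (spo_risk P wstar \<zeta> (erm n z \<omega>) \<omega> - spo_risk P wstar \<zeta> gstar \<omega>)) \<partial>iid P n)
            \<le> ennreal (\<kappa>_risk * real n powr (- \<alpha>))"
    and cond2: "D_v \<ge> 1" "\<And>a. a \<in> S \<Longrightarrow> AE (x, r, V) in P. N (transpose V *v a) \<le> D_v"
    and \<kappa>_MD: "\<kappa>_MD = D_v * (\<zeta> * sqrt D_Th + sqrt D_Lam)"
    and cond3: "\<And>\<epsilon>. \<epsilon> > 0 \<Longrightarrow>
          OPT_relaxed P X S \<V> u N \<epsilon> \<le> OPT P X S \<V> u + ereal (\<zeta>_OPT * \<epsilon>)"
  (* the ratio of the subgradient bounds to D_v, an absolute constant if these are O(D_v) *)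
    and \<rho>: "\<rho> = max 1 (max (G_Lam / D_v) (G_Th / D_v))"
  shows
    "(\<forall>\<^sub>F T in sequentially.
       OPT P X S \<V> u
         - ereal (\<integral>z. avg_reward T z (w T z) + u (avg_consumption T z (w T z)) \<partial>iid P T)
       \<le> ereal (10 * \<rho> * \<kappa>_MD * real T powr (- 1 / 2) + 10 * \<kappa>_risk * real T powr (- \<alpha>)))
     \<and>
    (\<zeta> \<ge> 2 * (\<zeta>_OPT + sqrt D_Lam / sqrt D_Th + \<kappa>_risk / (D_v * sqrt D_Th)) \<longrightarrow>
     (\<forall>\<^sub>F T in sequentially.
       (\<integral>z. dist_to N \<V> (avg_consumption T z (w T z)) \<partial>iid P T)
       \<le> 10 * \<rho> * (D_v * sqrt D_Th) * real T powr (- 1 / 2)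
          + 10 * (D_v * sqrt D_Th) * real T powr (- \<alpha>)))"
proof -

  \<comment> \<open>Bounds on decisions and dual variables\<close>
  interpret P: prob_space P by fact
  have u': "convex_on UNIV (\<lambda>v. - u v)" "\<And>a b. \<bar>- u a - - u b\<bar> \<le> L * N (a - b)"
    using u(1) u(2) by (auto simp: concave_on_def abs_minus_commute)
  note d' = dist_to_convex[OF N \<V>(3) \<V>(2)] dist_to_lipschitz[OF N \<V>(3)]
  note cont = lipschitz_continuous_on[OF N u'(2)] lipschitz_continuous_on[OF N d'(2)]
  obtain B1 where B1: "B1 > 0" "\<And>a. a \<in> \<Lambda> \<Longrightarrow> norm a \<le> B1"
    using conj_domain_bounded[OF N u'(2)] unfolding \<Lambda> by blast
  obtain B2 where B2: "B2 > 0" "\<And>a. a \<in> \<Theta> \<Longrightarrow> norm a \<le> B2"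
    using conj_domain_bounded[OF N d'(2)] unfolding \<Theta> by blast
  obtain K where K: "K > 0" "\<And>a. a \<in> S \<Longrightarrow> norm a \<le> K"
    using compact_imp_bounded[OF S(2)] unfolding bounded_pos by blast
  define B where "B = B1 + \<zeta> * B2"
  have dual_bound: "norm (a + \<zeta> *\<^sub>R b) \<le> B" if "a \<in> \<Lambda>" "b \<in> \<Theta>" for a b
    unfolding B_def
    by (rule norm_triangle_le) (use that B1 B2 \<zeta> in \<open>auto intro!: add_mono mult_left_mono\<close>)
  interpret D: decision_problem P X S \<Lambda> \<Theta> \<zeta> wstar gstar K B
  proof unfold_locales
    show "integrable P (\<lambda>z. fst (snd z))" "integrable P (\<lambda>z. snd (snd z))"
      using integrable by (simp_all add: case_prod_beta')
    show "closed S" by (rule compact_imp_closed[OF S(2)])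
    show "K \<ge> 0" "B \<ge> 0" using K B1 B2 \<zeta> by (auto simp: B_def)
  qed (use P(2) S(1) K(2) dual_bound wstar gstar in auto)

  \<comment> \<open>Dependence of the run on past observations\<close>
  have start: "lam T z (Suc 0) = lam1" "th T z (Suc 0) = th1" for T z
    using init(4)[of T z] init(5)[of T z] by simp_all
  have lam_in: "lam T z t \<in> \<Lambda>" if "z \<in> space (iid P T)" "t \<in> {1..T}" for T z t
    by (rule mirror_descent_in[OF md_Lam]) (use that init in auto)
  have th_in: "th T z t \<in> \<Theta>" if "z \<in> space (iid P T)" "t \<in> {1..T}" for T z t
    by (rule mirror_descent_in[OF md_Th]) (use that init in auto)
  have lam_past: "lam T z t = lam T (restrict z {1..t - 1}) t" if "t \<in> {1..T}" for T z t
    using adapted(1)[OF that] unfolding known_after_def by blast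
  have th_past: "th T z t = th T (restrict z {1..t - 1}) t" if "t \<in> {1..T}" for T z t
    using adapted(2)[OF that] unfolding known_after_def by blast
  have restrict_idem: "restrict (restrict z {1..n}) {1..n} = restrict z {1..n}"
    for z :: "nat \<Rightarrow> ('p, 'd, 'm) obs" and n by simp
  have g_past: "g T z t = g T (restrict z {1..t - 1}) t" if "t \<in> {1..T}" for T z t
    unfolding g[of T z t] g[of T "restrict z {1..t - 1}" t] restrict_idem
    using lam_past[OF that, of z] th_past[OF that, of z] by simp
  have restrict_space: "restrict y {1..n} = y" if "y \<in> space (iid P n)" for y n
    using that by (auto simp: space_PiM PiE_def extensional_restrict)

  have dual_in: "(lam T y t, th T y t) \<in> \<Lambda> \<times> \<Theta>" if t: "t \<in> {1..T}" and y: "y \<in> space (iid P (t - 1))" for T t y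
  proof -
    \<comment> \<open>Mirror descent is assumed for full sequences only, so the past
      \<open>y\<close> is completed by an arbitrary observation \<open>c\<close>; by adaptedness the
      dual variables of round t ignore the completion.\<close>
    obtain c where c: "c \<in> space P" using P.not_empty by blast
    define z where "z = restrict (\<lambda>i. if i \<le> t - 1 then y i else c) {1..T}"
    have z: "z \<in> space (iid P T)" using y c t by (auto simp: z_def space_PiM PiE_iff)
    have "restrict z {1..t - 1} = restrict y {1..t - 1}" using t by (auto simp: z_def fun_eq_iff restrict_def)
    then have zy: "restrict z {1..t - 1} = y" using restrict_space[OF y] by simp
    show ?thesis
      using lam_in[OF z t] th_in[OF z t] lam_past[OF t, of z] th_past[OF t, of z] unfolding zy by simp
  qed

  have round: "decision_round P X S \<Lambda> \<Theta> \<zeta> wstar gstar K B (iid P (t - 1))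
      (\<lambda>y. g T y t) (\<lambda>y. lam T y t) (\<lambda>y. th T y t)" if t: "t \<in> {1..T}" for T t
  proof -
    have dual_meas [measurable]: "(\<lambda>y. lam T y t) \<in> borel_measurable (iid P (t - 1))"
      "(\<lambda>y. th T y t) \<in> borel_measurable (iid P (t - 1))"
      using adapted(1,2)[OF t] unfolding known_after_def by blast+
    have meas: "(\<lambda>(y, x). g T y t x) \<in> borel_measurable (iid P (t - 1) \<Otimes>\<^sub>M context_space X)"
    proof (cases "t = 1")
      case True
      have [measurable]: "g1 \<in> borel_measurable (context_space X)" by (rule init(3))
      have "(\<lambda>p. g1 (snd p)) \<in> borel_measurable (iid P (t - 1) \<Otimes>\<^sub>M context_space X)" by measurable
      then show ?thesis by (simp add: g True case_prod_beta')
    next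
      case False
      then have n: "t - 1 > 0" using t by auto
      \<comment> \<open>The dual pair is itself a function of the sample, so the minimizer is
        evaluated at a sample-dependent pair; this is where its joint measurability in sample, pair
        and context enters.\<close>
      have "(\<lambda>p. ((restrict (fst p) {1..t - 1}, (lam T (fst p) t, th T (fst p) t)), snd p))
          \<in> iid P (t - 1) \<Otimes>\<^sub>M context_space X \<rightarrow>\<^sub>M (iid P (t - 1) \<Otimes>\<^sub>M borel) \<Otimes>\<^sub>M context_space X"
      proof (intro measurable_Pair borel_measurable_Pair)
        show "(\<lambda>p. restrict (fst p) {1..t - 1}) \<in> iid P (t - 1) \<Otimes>\<^sub>M context_space X \<rightarrow>\<^sub>M iid P (t - 1)"
          by (rule measurable_compose[OF measurable_fst measurable_restrict_subset]) simp
      qed measurable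
      from measurable_compose[OF this erm(2)[OF n]] show ?thesis
        using False by (simp add: g case_prod_beta')
    qed
    show ?thesis
      by (intro decision_round.intro decision_round_axioms.intro D.decision_problem_axioms P.PiM_prob_space
          meas dual_meas)
        (use dual_in[OF t] in auto)
  qed
  have run: "online_run P X S \<Lambda> \<Theta> \<zeta> wstar gstar K B T (lam T) (th T) (g T) (w T)" if "T > 0" for T
    by (intro online_run.intro online_run_axioms.intro D.decision_problem_axioms round that
        lam_past th_past g_past w)

  \<comment> \<open>Error terms and accumulated excess risk\<close>
  \<comment> \<open>Excess of the first round, which predicts with the arbitrary \<open>g1\<close>;
    the risk hypothesis speaks of at least one observation.\<close>
  define C where "C = spo_risk P wstar \<zeta> g1 (lam1, th1) - spo_risk P wstar \<zeta> gstar (lam1, th1)"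
  define ex where "ex T = (C + (\<Sum>n=1..T - 1. \<kappa>_risk * real n powr - \<alpha>)) / T" for T
  define A where "A T = (\<integral>z. avg_reward T z (w T z) + u (avg_consumption T z (w T z)) \<partial>iid P T)" for T
  define \<delta> where "\<delta> T = (\<integral>z. dist_to N \<V> (avg_consumption T z (w T z)) \<partial>iid P T)" for T
  define q where "q T = real T powr (- 1 / 2)" for T
  define r where "r T = real T powr - \<alpha>" for T
  define err where "err T = 3 / 2 * \<rho> * (D_v * (\<zeta> * sqrt D_Th + sqrt D_Lam)) * q T + ex T" for T
  have \<rho>_le: "\<rho> \<ge> 1" "G_Lam \<le> \<rho> * D_v" "G_Th \<le> \<rho> * D_v"
  proof -
    have "G_Lam / D_v \<le> \<rho>" "G_Th / D_v \<le> \<rho>" by (auto simp: \<rho>)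
    then show "G_Lam \<le> \<rho> * D_v" "G_Th \<le> \<rho> * D_v" using cond2(1) by (simp_all add: divide_le_eq)
  qed (simp add: \<rho>)

  have mean_excess: "(\<Sum>t=1..T. online_run.mean_excess P \<zeta> wstar gstar (lam T) (th T) (g T) t) / T \<le> ex T"
    if T: "T > 0" for T
  proof -
    interpret R: online_run P X S \<Lambda> \<Theta> \<zeta> wstar gstar K B T "lam T" "th T" "g T" "w T" by (rule run[OF T])
    have 1: "R.mean_excess 1 = C"
      using prob_space.prob_space[OF P.PiM_prob_space[of "{1..1 - 1 :: nat}"]]
      unfolding R.mean_excess_def init(4,5) g by (simp add: C_def)
    have Suc: "R.mean_excess (Suc n) \<le> \<kappa>_risk * real n powr - \<alpha>" if n: "n \<in> {1..T - 1}" for n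
    proof -
      have t: "Suc n \<in> {1..T}" "n > 0" using n by auto
      interpret DR: decision_round P X S \<Lambda> \<Theta> \<zeta> wstar gstar K B "iid P n"
        "\<lambda>y. g T y (Suc n)" "\<lambda>y. lam T y (Suc n)" "\<lambda>y. th T y (Suc n)"
        using round[OF t(1)] by simp
      have "(\<integral>y. DR.excess y \<partial>iid P n) \<le> \<kappa>_risk * real n powr - \<alpha>"
      proof (rule DR.integral_excess_le[OF cond1(3)[OF t(2)]])
        fix y assume y: "y \<in> space (iid P n)"
        have "g T y (Suc n) = erm n y (lam T y (Suc n), th T y (Suc n))"
          using t(2) restrict_space[OF y] by (simp add: g)
        then have "ennreal (DR.excess y) = ennreal (spo_risk P wstar \<zeta> (erm n y (lam T y (Suc n), th T y (Suc n))) (lam T y (Suc n), th T y (Suc n))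
            - spo_risk P wstar \<zeta> gstar (lam T y (Suc n), th T y (Suc n)))"
          by (simp add: DR.excess_def)
        \<comment> \<open>The dual pair of this round is computed from the very sample
          \<open>y\<close> that fits the model; the supremum covers any such dependence.\<close>
        also have "\<dots> \<le> (SUP \<omega>\<in>\<Lambda> \<times> \<Theta>. ennreal (spo_risk P wstar \<zeta> (erm n y \<omega>) \<omega> - spo_risk P wstar \<zeta> gstar \<omega>))"
          by (rule SUP_upper) (rule DR.dual_in[OF y])
        finally show "ennreal (DR.excess y)
          \<le> (SUP \<omega>\<in>\<Lambda> \<times> \<Theta>. ennreal (spo_risk P wstar \<zeta> (erm n y \<omega>) \<omega> - spo_risk P wstar \<zeta> gstar \<omega>))" .
      qed (use cond1(1) in simp)
      then show ?thesis by (simp add: R.mean_excess_def DR.excess_def)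
    qed
    have "(\<Sum>t=1..T. R.mean_excess t) = R.mean_excess 1 + (\<Sum>n=1..T - 1. R.mean_excess (Suc n))"
    proof -
      have "(\<Sum>t=1..T. R.mean_excess t) = R.mean_excess 1 + (\<Sum>t=Suc 1..Suc (T - 1). R.mean_excess t)"
        using T by (subst sum.atLeast_Suc_atMost) auto
      then show ?thesis by (simp only: sum.shift_bounds_cl_Suc_ivl)
    qed
    also have "\<dots> \<le> C + (\<Sum>n=1..T - 1. \<kappa>_risk * real n powr - \<alpha>)"
      unfolding 1 by (intro add_left_mono sum_mono Suc)
    finally show ?thesis unfolding ex_def by (rule divide_right_mono) simp
  qed

  \<comment> \<open>The algorithm against the benchmark, in both directions\<close>
  have bench: "rew P \<pi> + u (con P \<pi>) \<le> A T - \<zeta> * \<delta> T + err T"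
    if T: "T > 0" and \<pi>: "\<pi> \<in> policies X S" "con P \<pi> \<in> \<V>" for T \<pi>
  proof -
    interpret R: online_run P X S \<Lambda> \<Theta> \<zeta> wstar gstar K B T "lam T" "th T" "g T" "w T" by (rule run[OF T])
    have reg_lam: "AE z in iid P T. (\<Sum>t=1..T. (c - consumption z (w T z) t) \<bullet> lam T z t)
        \<le> T * u (avg_consumption T z (w T z)) - T * u c + 3 / 2 * (sqrt D_Lam * G_Lam * sqrt T)" for c
      using G_Lam(2)[OF T] AE_space
    proof eventually_elim
      case (elim z)
      show ?case
        using mirror_descent_regret[OF N u'(1) cont(1) \<Lambda> h_Lam D_Lam(1,2) G_Lam(1) T md_Lam[OF T elim(2)], of c]
          elim(1) init(1) start(1)[of T z] by (simp add: avg_consumption_def)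
    qed
    have reg_th: "AE z in iid P T. (\<Sum>t=1..T. (c - consumption z (w T z) t) \<bullet> th T z t)
        \<le> T * dist_to N \<V> c - T * dist_to N \<V> (avg_consumption T z (w T z)) + 3 / 2 * (sqrt D_Th * G_Th * sqrt T)" for c
      using G_Th(2)[OF T] AE_space
    proof eventually_elim
      case (elim z)
      show ?case
        using mirror_descent_regret[OF N d'(1) cont(2) \<Theta> h_Th D_Th(1,2) G_Th(1) T md_Th[OF T elim(2)], of c]
          elim(1) init(2) start(2)[of T z] by (simp add: avg_consumption_def)
    qed
    have "rew P \<pi> + u (con P \<pi>) \<le> A T - \<zeta> * \<delta> T
        + (3 / 2 * (sqrt D_Lam * G_Lam * sqrt T) + \<zeta> * (3 / 2 * (sqrt D_Th * G_Th * sqrt T))) / T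
        + (\<Sum>t=1..T. R.mean_excess t) / T"
      unfolding A_def \<delta>_def by (rule R.benchmark_le[OF \<pi> N u(2) \<V>(3) \<zeta> reg_lam reg_th])
    moreover have "(3 / 2 * (sqrt D_Lam * G_Lam * sqrt T) + \<zeta> * (3 / 2 * (sqrt D_Th * G_Th * sqrt T))) / T
        = 3 / 2 * (sqrt D_Lam * G_Lam + \<zeta> * (sqrt D_Th * G_Th)) * q T"
    proof -
      have "q T = 1 / sqrt T" using T by (simp add: q_def powr_minus_divide powr_half_sqrt)
      then have "q T * sqrt T * sqrt T = sqrt T" using T by simp
      then have "sqrt T = q T * T" by (simp add: mult.assoc)
      then show ?thesis using T by (simp add: field_simps)
    qed
    moreover have "\<dots> \<le> 3 / 2 * \<rho> * (D_v * (\<zeta> * sqrt D_Th + sqrt D_Lam)) * q T"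
    proof -
      have "sqrt D_Lam * G_Lam + \<zeta> * (sqrt D_Th * G_Th) \<le> sqrt D_Lam * (\<rho> * D_v) + \<zeta> * (sqrt D_Th * (\<rho> * D_v))"
        using D_Lam D_Th \<zeta> \<rho>_le by (intro add_mono mult_left_mono) auto
      then have "3 / 2 * (sqrt D_Lam * G_Lam + \<zeta> * (sqrt D_Th * G_Th)) * q T
          \<le> 3 / 2 * (sqrt D_Lam * (\<rho> * D_v) + \<zeta> * (sqrt D_Th * (\<rho> * D_v))) * q T"
        by (intro mult_right_mono mult_left_mono) (auto simp: q_def)
      then show ?thesis by (simp add: algebra_simps)
    qed
    ultimately show ?thesis using mean_excess[OF T] unfolding err_def by linarith
  qed

  have avg_policy: "\<exists>\<pi>\<in>policies X S. dist_to N \<V> (con P \<pi>) \<le> \<delta> T \<and> A T \<le> rew P \<pi> + u (con P \<pi>)"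
    if T: "T > 0" for T
  proof -
    interpret R: online_run P X S \<Lambda> \<Theta> \<zeta> wstar gstar K B T "lam T" "th T" "g T" "w T" by (rule run[OF T])
    note int_u = R.iid.lipschitz_integrable[OF N u'(2) R.integrable_avg(2)]
    note int_d = R.iid.lipschitz_integrable[OF N d'(2) R.integrable_avg(2)]
    obtain \<pi> where \<pi>: "\<pi> \<in> policies X S" "rew P \<pi> = (\<integral>z. avg_reward T z (w T z) \<partial>iid P T)"
      "con P \<pi> = (\<integral>z. avg_consumption T z (w T z) \<partial>iid P T)"
      by (rule R.averaged_policy)
    \<comment> \<open>Jensen's inequality for the convex distance and, below, for the convex
      \<open>- u\<close>: averaging can only help the policy.\<close>
    have "dist_to N \<V> (con P \<pi>) \<le> \<delta> T"
      unfolding \<delta>_def \<pi>(3) by (rule R.iid.jensen_euclidean[OF d'(1) cont(2) R.integrable_avg(2) int_d])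
    moreover have "- u (con P \<pi>) \<le> (\<integral>z. - u (avg_consumption T z (w T z)) \<partial>iid P T)"
      unfolding \<pi>(3) by (rule R.iid.jensen_euclidean[OF u'(1) cont(1) R.integrable_avg(2) int_u])
    then have "A T \<le> rew P \<pi> + u (con P \<pi>)"
      unfolding A_def \<pi>(2) using R.integrable_avg(1) int_u by simp
    ultimately show ?thesis using \<pi>(1) by blast
  qed

  \<comment> \<open>If no policy is feasible, the supremum is minus infinity and the bound
    persists.\<close>
  have OPT_le: "OPT P X S \<V> u \<le> ereal (A T - \<zeta> * \<delta> T + err T)" if "T > 0" for T
    unfolding OPT_def by (rule SUP_least) (use bench[OF that] in auto)

  have \<delta>_nonneg: "\<delta> T \<ge> 0" for T
    unfolding \<delta>_def by (rule Bochner_Integration.integral_nonneg_AE) (simp add: dist_to_nonneg[OF N \<V>(3)])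

  \<comment> \<open>Rates for large horizons\<close>
  \<comment> \<open>This weight is one of the two summands of \<open>\<rho> * \<kappa>_MD\<close>,
    so it fits into the first bound, and it is proportional to \<open>\<zeta>\<close>, so that the
    \<open>\<zeta> / 2\<close> of the penalty margin pays for it in the second.\<close>
  define s where "s = \<rho> * D_v * \<zeta> * sqrt D_Th"
  have "s > 0" using \<rho>_le(1) cond2(1) \<zeta> D_Th(1) by (simp add: s_def)
  from eventually_mean_rate_le[OF cond1(2,1) this, of C]
  have rate: "\<forall>\<^sub>F T in sequentially. ex T \<le> 2 * \<kappa>_risk * r T + s * q T"
    by (simp add: ex_def r_def q_def)

  show ?thesis
  proof (intro conjI impI)
    show "\<forall>\<^sub>F T in sequentially.
       OPT P X S \<V> u
         - ereal (\<integral>z. avg_reward T z (w T z) + u (avg_consumption T z (w T z)) \<partial>iid P T)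
       \<le> ereal (10 * \<rho> * \<kappa>_MD * real T powr (- 1 / 2) + 10 * \<kappa>_risk * real T powr (- \<alpha>))"
      using rate eventually_gt_at_top[of 0]
    proof eventually_elim
      case (elim T)
      have pos: "\<rho> * D_v * \<zeta> * sqrt D_Th * q T \<ge> 0" "\<rho> * D_v * sqrt D_Lam * q T \<ge> 0" "\<kappa>_risk * r T \<ge> 0"
        "\<zeta> * \<delta> T \<ge> 0"
        using \<rho>_le(1) cond2(1) \<zeta> D_Th(1) D_Lam(1) cond1(1) \<delta>_nonneg[of T] by (simp_all add: q_def r_def)
      have "err T \<le> 3 / 2 * (\<rho> * D_v * \<zeta> * sqrt D_Th * q T) + 3 / 2 * (\<rho> * D_v * sqrt D_Lam * q T)
          + 2 * (\<kappa>_risk * r T) + \<rho> * D_v * \<zeta> * sqrt D_Th * q T"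
        using elim(1) by (simp add: err_def s_def algebra_simps)
      moreover have "10 * \<rho> * \<kappa>_MD * q T + 10 * \<kappa>_risk * r T
          = 10 * (\<rho> * D_v * \<zeta> * sqrt D_Th * q T) + 10 * (\<rho> * D_v * sqrt D_Lam * q T) + 10 * (\<kappa>_risk * r T)"
        by (simp add: \<kappa>_MD algebra_simps)
      \<comment> \<open>The nonpositive term with \<open>\<delta> T\<close> is discarded here; the
        second bound lives on it.\<close>
      ultimately have "A T - \<zeta> * \<delta> T + err T - A T \<le> 10 * \<rho> * \<kappa>_MD * q T + 10 * \<kappa>_risk * r T"
        using pos by linarith
      moreover have "OPT P X S \<V> u - ereal (A T) \<le> ereal (A T - \<zeta> * \<delta> T + err T) - ereal (A T)"
        by (intro ereal_minus_mono OPT_le elim) simp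
      ultimately have "OPT P X S \<V> u - ereal (A T) \<le> ereal (10 * \<rho> * \<kappa>_MD * q T + 10 * \<kappa>_risk * r T)"
        by (auto intro: order_trans)
      then show ?case by (simp add: A_def q_def r_def)
    qed
  next
    assume pen: "\<zeta> \<ge> 2 * (\<zeta>_OPT + sqrt D_Lam / sqrt D_Th + \<kappa>_risk / (D_v * sqrt D_Th))"
    show "\<forall>\<^sub>F T in sequentially.
       (\<integral>z. dist_to N \<V> (avg_consumption T z (w T z)) \<partial>iid P T)
       \<le> 10 * \<rho> * (D_v * sqrt D_Th) * real T powr (- 1 / 2)
          + 10 * (D_v * sqrt D_Th) * real T powr (- \<alpha>)"
      using rate eventually_gt_at_top[of 0]
    proof eventually_elim
      case (elim T)
      obtain \<pi> where \<pi>: "\<pi> \<in> policies X S" "dist_to N \<V> (con P \<pi>) \<le> \<delta> T" "A T \<le> rew P \<pi> + u (con P \<pi>)"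
        using avg_policy[OF elim(2)] by blast
      \<comment> \<open>Since \<open>\<delta> T\<close> may be 0 while the relaxed benchmark is
        controlled for positive tolerances only, the tolerance is \<open>\<delta> T + e\<close>,
        with \<open>e\<close> tending to 0 afterwards. The benchmark itself is eliminated between
        its upper and lower estimates.\<close>
      have le: "\<zeta> * \<delta> T \<le> \<zeta>_OPT * (\<delta> T + e) + err T" if "e > 0" for e
      proof -
        have "ereal (A T) \<le> ereal (rew P \<pi> + u (con P \<pi>))" using \<pi>(3) by simp
        also have "\<dots> \<le> OPT_relaxed P X S \<V> u N (\<delta> T + e)"
          unfolding OPT_relaxed_def by (rule SUP_upper) (use \<pi> that in auto)
        also have "\<dots> \<le> OPT P X S \<V> u + ereal (\<zeta>_OPT * (\<delta> T + e))"
          by (rule cond3) (use \<delta>_nonneg[of T] that in simp)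
        also have "\<dots> \<le> ereal (A T - \<zeta> * \<delta> T + err T) + ereal (\<zeta>_OPT * (\<delta> T + e))"
          by (intro add_right_mono OPT_le elim)
        finally show ?thesis by simp
      qed
      have "\<zeta> * \<delta> T \<le> \<zeta>_OPT * \<delta> T + err T"
      proof (rule tendsto_lowerbound)
        show "((\<lambda>e. \<zeta>_OPT * (\<delta> T + e) + err T) \<longlongrightarrow> \<zeta>_OPT * \<delta> T + err T) (at_right 0)"
          by (rule tendsto_eq_intros refl | simp)+
        show "\<forall>\<^sub>F e in at_right 0. \<zeta> * \<delta> T \<le> \<zeta>_OPT * (\<delta> T + e) + err T"
          using le by (auto simp: eventually_at_filter)
      qed simp
      also have "\<dots> \<le> \<zeta>_OPT * \<delta> T + (3 / 2 * \<rho> * (D_v * (\<zeta> * sqrt D_Th + sqrt D_Lam)) * q T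
          + (2 * \<kappa>_risk * r T + \<rho> * D_v * \<zeta> * sqrt D_Th * q T))"
        using elim(1) by (simp add: err_def s_def)
      finally have "\<delta> T \<le> 10 * \<rho> * (D_v * sqrt D_Th) * q T + 10 * (D_v * sqrt D_Th) * r T"
        by (intro penalty_rate[OF _ _ _ cond1(1) \<zeta> _ _ _ pen])
          (use cond2(1) D_Lam(1) D_Th(1) \<rho>_le(1) in \<open>auto simp: q_def r_def\<close>)
      then show ?case by (simp add: \<delta>_def q_def r_def)
    qed
  qed
qed

end
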